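(* Let $H$ be a complex Hilbert space, and let $a,b$ be elements in $C_p(H)$ for some $1\leq p\leq\infty$. Let $\{\mu_n(a): n\in\mathbb{N}\}$ and $\{\mu_n(b): n\in\mathbb{N}\}$ be the singular values of $a$ and $b$, respectively. Then $$\sum_{n=1}^{\infty}|\mu_n(a)-\mu_n(b)|^p\leq\|a-b\|_p^p,$$ where for $p=\infty$ the inequality is read as $\sup_{n\in\mathbb{N}}|\mu_n(a)-\mu_n(b)|\leq\|a-b\|_{\infty}$.
   Context: $B(H)$ is the space of bounded linear operators on $H$, $K(H)$ is the space of compact linear operators on $H$, and $|a|=(a^*a)^{1/2}$. For $a\in K(H)$, the singular values $(\mu_n(a))_{n\in\mathbb{N}}$ of $a$ are the eigenvalues of $|a|$ arranged in decreasing order $\mu_1(a)\geq\mu_2(a)\geq\cdots\geq 0$ and repeated according to multiplicity; if $|a|$ has infinitely many positive eigenvalues (counted with multiplicity) these make up the whole sequence, and if it has only finitely many the sequence is completed with zeros. For $1\leq p<\infty$, $C_p(H)$ is the Banach space of $p$-Schatten von Neumann operators, that is, of all $a\in K(H)$ with $\|a\|_p^p:=\mathrm{tr}(|a|^p)=\sum_{n=1}^{\infty}\mu_n(a)^p<\infty$, where $\mathrm{tr}$ is the usual trace on $B(H)$. The symbol $C_{\infty}(H)$ stands for $B(H)$, and $\|\cdot\|_{\infty}$ is the operator norm on $B(H)$. *)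

theory Defs
  imports "HOL-Analysis.Analysis"
begin

text \<open>Complex Hilbert spaces. The inner product is linear in the first argument and
  conjugate-linear in the second. The real structure (hence the type of bounded operators, the
  norm and the topology) is the one induced by the complex structure.\<close>

class complex_hilbert = real_normed_vector + complete_space +
  fixes scaleC :: "complex \<Rightarrow> 'a \<Rightarrow> 'a" (infixr "*\<^sub>C" 75)
    and cinner :: "'a \<Rightarrow> 'a \<Rightarrow> complex"
  assumes scaleC_add_right: "c *\<^sub>C (x + y) = c *\<^sub>C x + c *\<^sub>C y"
    and scaleC_add_left: "(c + d) *\<^sub>C x = c *\<^sub>C x + d *\<^sub>C x"
    and scaleC_scaleC: "c *\<^sub>C (d *\<^sub>C x) = (c * d) *\<^sub>C x"
    and scaleC_one: "1 *\<^sub>C x = x"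
    and scaleR_eq_scaleC: "r *\<^sub>R x = complex_of_real r *\<^sub>C x"
    and cinner_commute: "cinner x y = cnj (cinner y x)"
    and cinner_add_left: "cinner (x + y) z = cinner x z + cinner y z"
    and cinner_scaleC_left: "cinner (c *\<^sub>C x) y = c * cinner x y"
    and cinner_self: "cinner x x = complex_of_real ((norm x)\<^sup>2)"

global_interpretation complex_vector: vector_space "scaleC :: complex \<Rightarrow> 'a \<Rightarrow> 'a::complex_hilbert"
  defines cspan = complex_vector.span
    and cdim = complex_vector.dim
  by standard (simp_all add: scaleC_add_right scaleC_add_left scaleC_scaleC scaleC_one)

instantiation complex :: complex_hilbert
begin

definition scaleC_complex :: "complex \<Rightarrow> complex \<Rightarrow> complex" where
  "scaleC_complex c x = c * x"

definition cinner_complex :: "complex \<Rightarrow> complex \<Rightarrow> complex" where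
  "cinner_complex x y = x * cnj y"

instance
  by standard
    (simp_all add: scaleC_complex_def cinner_complex_def algebra_simps scaleR_conv_of_real
      complex_norm_square del: of_real_power)

end

text \<open>The type \<open>'a \<Rightarrow>\<^sub>L 'a\<close> consists of the real-linear bounded maps, with the operator norm; the
  elements of \<open>B(H)\<close> are those that are complex-linear.\<close>

definition bounded_ops :: "('a::complex_hilbert \<Rightarrow>\<^sub>L 'a) set" where
  "bounded_ops = {a. \<forall>c x. blinfun_apply a (c *\<^sub>C x) = c *\<^sub>C blinfun_apply a x}"

definition compact_ops :: "('a::complex_hilbert \<Rightarrow>\<^sub>L 'a) set" where
  "compact_ops = {a \<in> bounded_ops. compact (closure (blinfun_apply a ` cball 0 1))}"

definition adjoint_op :: "('a::complex_hilbert \<Rightarrow>\<^sub>L 'a) \<Rightarrow> ('a \<Rightarrow>\<^sub>L 'a)" where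
  "adjoint_op a = (THE b. \<forall>x y. cinner (blinfun_apply a x) y = cinner x (blinfun_apply b y))"

definition positive_op :: "('a::complex_hilbert \<Rightarrow>\<^sub>L 'a) \<Rightarrow> bool" where
  "positive_op a \<longleftrightarrow> a \<in> bounded_ops \<and> (\<forall>x. cinner (blinfun_apply a x) x \<in> \<real> \<and> 0 \<le> Re (cinner (blinfun_apply a x) x))"

definition sqrt_op :: "('a::complex_hilbert \<Rightarrow>\<^sub>L 'a) \<Rightarrow> ('a \<Rightarrow>\<^sub>L 'a)" where
  "sqrt_op a = (THE r. positive_op r \<and> r o\<^sub>L r = a)"

definition abs_op :: "('a::complex_hilbert \<Rightarrow>\<^sub>L 'a) \<Rightarrow> ('a \<Rightarrow>\<^sub>L 'a)" where
  "abs_op a = sqrt_op (adjoint_op a o\<^sub>L a)"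

text \<open>\<open>cdim\<close> is 0 on infinite-dimensional subspaces. This is harmless here: \<open>eigen_mult\<close> is only
  used at positive eigenvalues of compact operators, whose eigenspaces are finite-dimensional.\<close>

definition eigen_mult :: "('a::complex_hilbert \<Rightarrow>\<^sub>L 'a) \<Rightarrow> real \<Rightarrow> nat" where
  "eigen_mult a l = cdim {x. blinfun_apply a x = complex_of_real l *\<^sub>C x}"

text \<open>A decreasing nonnegative sequence listing each positive eigenvalue of \<open>|a|\<close> exactly as
  often as its multiplicity, and no other positive number. If there are only finitely many
  positive eigenvalues this forces the remaining entries to be zero; if there are infinitely many
  they fill the whole sequence, so that a possible eigenvalue zero does not occur.\<close>

definition is_singular_value_seq :: "('a::complex_hilbert \<Rightarrow>\<^sub>L 'a) \<Rightarrow> (nat \<Rightarrow> real) \<Rightarrow> bool" where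
  "is_singular_value_seq a s \<longleftrightarrow>
     decseq s \<and> (\<forall>n. 0 \<le> s n) \<and>
     (\<forall>l>0. finite {n. s n = l} \<and> card {n. s n = l} = eigen_mult (abs_op a) l)"

text \<open>The \<open>n\<close>-th approximation number, counted from 0: the distance of \<open>a\<close> to the operators of
  rank at most \<open>n\<close>.\<close>

definition approx_number :: "('a::complex_hilbert \<Rightarrow>\<^sub>L 'a) \<Rightarrow> nat \<Rightarrow> real" where
  "approx_number a n =
     (INF f \<in> {f \<in> bounded_ops. \<exists>B. finite B \<and> card B \<le> n \<and> range (blinfun_apply f) \<subseteq> cspan B}.
        norm (a - f))"

text \<open>Singular values, indexed from 0: \<open>singular_value a n\<close> is \<open>\<mu>\<^sub>n\<^sub>+\<^sub>1(a)\<close>. For a non-compact operator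
  the eigenvalues of \<open>|a|\<close> need not be arrangeable as a decreasing sequence (there may be none at
  all); since \<open>C\<^sub>\<infinity>(H)\<close> is all of \<open>B(H)\<close>, the singular values of such an operator are its
  approximation numbers, the usual extension to \<open>B(H)\<close>: for compact operators approximation numbers
  and eigenvalues of \<open>|a|\<close> give the same sequence.\<close>

definition singular_value :: "('a::complex_hilbert \<Rightarrow>\<^sub>L 'a) \<Rightarrow> nat \<Rightarrow> real" where
  "singular_value a =
     (if a \<in> compact_ops then THE s. is_singular_value_seq a s else approx_number a)"

text \<open>For \<open>1 \<le> p < \<infinity>\<close>, \<open>schatten_power p a\<close> is \<open>\<parallel>a\<parallel>\<^sub>p\<^sup>p\<close>, as an extended nonnegative real.\<close>

definition schatten_power :: "real \<Rightarrow> ('a::complex_hilbert \<Rightarrow>\<^sub>L 'a) \<Rightarrow> ennreal" where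
  "schatten_power p a = (\<Sum>n. ennreal (singular_value a n powr p))"

definition schatten_class :: "ennreal \<Rightarrow> ('a::complex_hilbert \<Rightarrow>\<^sub>L 'a) set" where
  "schatten_class p =
     (if p = \<infinity> then bounded_ops
      else {a \<in> compact_ops. schatten_power (enn2real p) a < \<infinity>})"

end

theory Submission
  imports Defs
begin

text \<open>The argument is an interpolation between the endpoints \<open>p = 1\<close> and
  \<open>p = \<infinity>\<close>, and the threshold sums with parameter \<open>t\<close> are the
  form in which both endpoint estimates can be used at once. The hard endpoint is
  \<open>p = 1\<close>: the differences of singular values have no fixed sign, so comparing
  \<open>a\<close> with \<open>b\<close> by monotonicity alone loses the absolute values. A common
  majorant of both dilations keeps them. At its upper end it sees the larger of the two
  \<open>i\<close>-th singular values, at its lower end the smaller one with a minus sign, and the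
  two together exceed \<open>2 * K\<close> by exactly the absolute difference. The shift
  \<open>K\<close> makes the majorant positive, so that it is a sum of positive rank-one operators
  whose trace is a sum of squared norms; it cancels in the final comparison. Rank one enters because
  the form \<open>2 * Re (x * cnj y)\<close> is half of \<open>(cmod (x + y))\<^sup>2\<close> minus
  half of \<open>(cmod (x - y))\<^sup>2\<close>, and the first square is again the form of one
  rank-one operator.\<close>

text \<open>A compact operator has a Schmidt decomposition, which identifies its singular values with its
  approximation numbers; these are 1-Lipschitz for the operator norm. For finite \<open>p\<close> everything
  reduces to a rank-one perturbation \<open>a = b + \<langle>-, h\<rangle> f\<close> of a finite-rank \<open>b\<close>, for which
  \<open>\<Sum>\<^sub>i \<bar>s\<^sub>i(a) - s\<^sub>i(b)\<bar> \<le> \<parallel>f\<parallel> \<parallel>h\<parallel>\<close>: on a product of two \<open>m\<close>-dimensional spaces, the self-adjoint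
  dilations of \<open>a\<close> and \<open>b\<close> are both dominated by one operator \<open>D\<close>, the dilation of \<open>b\<close> plus a
  positive rank-one operator. By a dimension count, \<open>K + s\<^sub>i\<close> and \<open>K - s\<^sub>i\<close> bound the \<open>i\<close>-th largest and
  \<open>i\<close>-th smallest singular values of \<open>K + D\<close> from below, while the trace of \<open>D\<close> is only that of the
  rank-one operator.

  Splitting \<open>a - b\<close> into a finite-rank part of trace norm \<open>\<Sum>\<^sub>j (s\<^sub>j(a - b) - t)\<^sub>+\<close> and a rest of norm at
  most \<open>t\<close> then gives \<open>\<Sum>\<^sub>i (\<bar>s\<^sub>i(a) - s\<^sub>i(b)\<bar> - t)\<^sub>+ \<le> \<Sum>\<^sub>j (s\<^sub>j(a - b) - t)\<^sub>+\<close> for all \<open>t > 0\<close>, and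
  integrating against \<open>p (p - 1) t\<^sup>p\<^sup>-\<^sup>2\<close> yields the claim.\<close>

section \<open>Complex Hilbert spaces\<close>

text \<open>Completeness of the space of operators is inherited from that of the target, and this
  instance makes it available: adjoints and moduli arise below as norm limits.\<close>

instance complex_hilbert \<subseteq> banach ..

lemma cinner_add_right: "cinner x (y + z) = cinner x y + cinner (x::'a::complex_hilbert) z"
  by (metis cinner_add_left cinner_commute complex_cnj_add)

lemma cinner_scaleC_right: "cinner x (c *\<^sub>C y) = cnj c * cinner (x::'a::complex_hilbert) y"
  by (metis cinner_commute cinner_scaleC_left complex_cnj_mult)

lemma cinner_zero_left [simp]: "cinner 0 (x::'a::complex_hilbert) = 0"
  using cinner_add_left[of 0 0 x] by simp

lemma cinner_zero_right [simp]: "cinner (x::'a::complex_hilbert) 0 = 0"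
  using cinner_add_right[of x 0 0] by simp

lemma cinner_minus_left: "cinner (- x) y = - cinner (x::'a::complex_hilbert) y"
  using cinner_add_left[of x "- x" y] by (simp add: eq_neg_iff_add_eq_0 add.commute)

lemma cinner_minus_right: "cinner x (- y) = - cinner (x::'a::complex_hilbert) y"
  using cinner_add_right[of x y "- y"] by (simp add: eq_neg_iff_add_eq_0 add.commute)

lemma cinner_diff_left: "cinner (x - y) z = cinner x z - cinner (y::'a::complex_hilbert) z"
  using cinner_add_left[of x "- y" z] by (simp add: cinner_minus_left)

lemma cinner_diff_right: "cinner x (y - z) = cinner x y - cinner (x::'a::complex_hilbert) z"
  using cinner_add_right[of x y "- z"] by (simp add: cinner_minus_right)

lemma cinner_scaleR_left: "cinner (r *\<^sub>R x) y = complex_of_real r * cinner (x::'a::complex_hilbert) y"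
  by (simp add: scaleR_eq_scaleC cinner_scaleC_left)

lemma cinner_scaleR_right: "cinner x (r *\<^sub>R y) = complex_of_real r * cinner (x::'a::complex_hilbert) y"
  by (simp add: scaleR_eq_scaleC cinner_scaleC_right)

lemma cinner_sum_left: "cinner (sum f A) y = (\<Sum>i\<in>A. cinner (f i) (y::'a::complex_hilbert))"
  by (induction A rule: infinite_finite_induct) (simp_all add: cinner_add_left)

lemma cinner_sum_right: "cinner y (sum f A) = (\<Sum>i\<in>A. cinner (y::'a::complex_hilbert) (f i))"
  by (induction A rule: infinite_finite_induct) (simp_all add: cinner_add_right)

lemmas cinner_simps = cinner_add_left cinner_add_right cinner_scaleC_left cinner_scaleC_right
  cinner_minus_left cinner_minus_right cinner_diff_left cinner_diff_right
  cinner_scaleR_left cinner_scaleR_right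

lemma Re_cinner_self: "Re (cinner x x) = (norm (x::'a::complex_hilbert))\<^sup>2"
  by (simp add: cinner_self)

lemma cinner_self_eq_0 [simp]: "cinner x x = 0 \<longleftrightarrow> (x::'a::complex_hilbert) = 0"
  by (simp add: cinner_self)

lemma norm_scaleC [simp]: "norm (c *\<^sub>C x) = cmod c * norm (x::'a::complex_hilbert)"
proof -
  have "complex_of_real ((norm (c *\<^sub>C x))\<^sup>2) = complex_of_real ((cmod c * norm x)\<^sup>2)"
    by (simp only: cinner_self[symmetric] cinner_scaleC_left cinner_scaleC_right)
      (simp add: cinner_self power_mult_distrib complex_norm_square[symmetric] mult_ac)
  then have "(norm (c *\<^sub>C x))\<^sup>2 = (cmod c * norm x)\<^sup>2"
    using of_real_eq_iff by blast
  then show ?thesis by (simp add: power2_eq_iff_nonneg)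
qed

lemma Re_cinner_commute: "Re (cinner y x) = Re (cinner x (y::'a::complex_hilbert))"
  by (subst cinner_commute) simp

lemma norm_add_square:
  "(norm (x + y))\<^sup>2 = (norm x)\<^sup>2 + 2 * Re (cinner x y) + (norm (y::'a::complex_hilbert))\<^sup>2"
  unfolding Re_cinner_self[symmetric] by (simp add: cinner_simps Re_cinner_commute[of y x])

lemma norm_diff_square:
  "(norm (x - y))\<^sup>2 = (norm x)\<^sup>2 - 2 * Re (cinner x y) + (norm (y::'a::complex_hilbert))\<^sup>2"
  unfolding Re_cinner_self[symmetric] by (simp add: cinner_simps Re_cinner_commute[of y x])

lemma parallelogram:
  "(norm (x + y))\<^sup>2 + (norm (x - y))\<^sup>2 = 2 * (norm x)\<^sup>2 + 2 * (norm (y::'a::complex_hilbert))\<^sup>2"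
  by (simp add: norm_add_square norm_diff_square)

lemma norm_add_square_orthogonal:
  "cinner x y = 0 \<Longrightarrow> (norm (x + y))\<^sup>2 = (norm x)\<^sup>2 + (norm (y::'a::complex_hilbert))\<^sup>2"
  by (simp add: norm_add_square)

lemma Cauchy_Schwarz_cinner: "cmod (cinner x y) \<le> norm x * norm (y::'a::complex_hilbert)"
proof (cases "y = 0")
  case False
  define c where "c = cinner x y / (norm y)\<^sup>2"
  have n: "norm y > 0" using False by simp
  have "cinner (x - c *\<^sub>C y) y = 0"
    using n by (simp add: cinner_simps cinner_self c_def)
  then have "cinner (x - c *\<^sub>C y) (c *\<^sub>C y) = 0" by (simp add: cinner_simps)
  from norm_add_square_orthogonal[OF this]
  have "(norm (c *\<^sub>C y))\<^sup>2 \<le> (norm x)\<^sup>2" by simp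
  then have "cmod c * norm y \<le> norm x" by (simp add: abs_le_square_iff[symmetric])
  moreover have "cmod c * norm y = cmod (cinner x y) / norm y"
    using n by (simp add: c_def norm_divide norm_power norm_mult power2_eq_square)
  ultimately show ?thesis using n by (simp add: field_simps)
qed simp

lemma tendsto_cinner:
  fixes f g :: "'b \<Rightarrow> 'a::complex_hilbert"
  assumes "(f \<longlongrightarrow> x) F" "(g \<longlongrightarrow> y) F"
  shows "((\<lambda>i. cinner (f i) (g i)) \<longlongrightarrow> cinner x y) F"
proof -
  have "bounded_bilinear (cinner :: 'a \<Rightarrow> 'a \<Rightarrow> complex)"
    by standard
      (use Cauchy_Schwarz_cinner in \<open>auto simp: cinner_simps scaleR_conv_of_real intro!: exI[of _ 1]\<close>)
  from bounded_bilinear.tendsto[OF this assms] show ?thesis .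
qed

lemma closed_orthogonal: "closed {x::'a::complex_hilbert. \<forall>j\<in>J. cinner x (f j) = 0}"
proof -
  have "closed {x::'a. cinner x (f j) = 0}" for j
    unfolding closed_sequential_limits
  proof safe
    fix g and l :: 'a
    assume "\<forall>n. g n \<in> {x. cinner x (f j) = 0}" and "g \<longlonglongrightarrow> l"
    then have "(\<lambda>n. 0) \<longlonglongrightarrow> cinner l (f j)"
      using tendsto_cinner[of g l sequentially "\<lambda>_. f j" "f j"] by simp
    then show "cinner l (f j) = 0" by (simp add: LIMSEQ_const_iff)
  qed
  then have "closed (\<Inter>j\<in>J. {x::'a. cinner x (f j) = 0})" by blast
  moreover have "(\<Inter>j\<in>J. {x::'a. cinner x (f j) = 0}) = {x. \<forall>j\<in>J. cinner x (f j) = 0}" by auto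
  ultimately show ?thesis by simp
qed

section \<open>Orthogonal families, finite projections and Bessel's inequality\<close>

lemma norm_sum_square_orthogonal:
  fixes x :: "'i \<Rightarrow> 'a::complex_hilbert"
  assumes "finite J" "\<And>i j. i \<in> J \<Longrightarrow> j \<in> J \<Longrightarrow> i \<noteq> j \<Longrightarrow> cinner (x i) (x j) = 0"
  shows "(norm (\<Sum>j\<in>J. c j *\<^sub>C x j))\<^sup>2 = (\<Sum>j\<in>J. (cmod (c j))\<^sup>2 * (norm (x j))\<^sup>2)"
  using assms
proof (induction J rule: finite_induct)
  case (insert i J)
  have "cinner (c i *\<^sub>C x i) (\<Sum>j\<in>J. c j *\<^sub>C x j) = 0"
    unfolding cinner_sum_right
    using insert(2) insert(4) by (intro sum.neutral ballI) (auto simp: cinner_simps)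
  then show ?case using insert by (simp add: norm_add_square_orthogonal power_mult_distrib)
qed simp

definition ortho_family :: "('i \<Rightarrow> 'a::complex_hilbert) \<Rightarrow> 'i set \<Rightarrow> bool" where
  "ortho_family e J \<longleftrightarrow>
     (\<forall>i\<in>J. \<forall>j\<in>J. i \<noteq> j \<longrightarrow> cinner (e i) (e j) = 0) \<and> (\<forall>i\<in>J. norm (e i) = 0 \<or> norm (e i) = 1)"

definition ortho_proj :: "('i \<Rightarrow> 'a::complex_hilbert) \<Rightarrow> 'i set \<Rightarrow> 'a \<Rightarrow> 'a" where
  "ortho_proj e J x = (\<Sum>j\<in>J. cinner x (e j) *\<^sub>C e j)"

lemma ortho_family_subset: "ortho_family e J \<Longrightarrow> I \<subseteq> J \<Longrightarrow> ortho_family e I"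
  by (auto simp: ortho_family_def)

lemma cinner_ortho_proj:
  assumes "ortho_family e J" "finite J" "i \<in> J"
  shows "cinner (ortho_proj e J x) (e i) = cinner x (e i)"
proof -
  have "cinner (ortho_proj e J x) (e i) = (\<Sum>j\<in>J. if j = i then cinner x (e i) else 0)"
    unfolding ortho_proj_def cinner_sum_left cinner_scaleC_left
    using assms by (intro sum.cong) (auto simp: ortho_family_def cinner_self)
  then show ?thesis using assms by simp
qed

lemma cinner_ortho_proj_rest:
  "ortho_family e J \<Longrightarrow> finite J \<Longrightarrow> i \<in> J \<Longrightarrow> cinner (x - ortho_proj e J x) (e i) = 0"
  by (simp add: cinner_simps cinner_ortho_proj)

lemma norm_ortho_proj:
  assumes "ortho_family e J" "finite J"
  shows "(norm (ortho_proj e J x))\<^sup>2 = (\<Sum>j\<in>J. (cmod (cinner x (e j)))\<^sup>2)"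
proof -
  have "(norm (ortho_proj e J x))\<^sup>2 = (\<Sum>j\<in>J. (cmod (cinner x (e j)))\<^sup>2 * (norm (e j))\<^sup>2)"
    unfolding ortho_proj_def
    by (rule norm_sum_square_orthogonal) (use assms in \<open>auto simp: ortho_family_def\<close>)
  also have "\<dots> = (\<Sum>j\<in>J. (cmod (cinner x (e j)))\<^sup>2)"
    using assms by (intro sum.cong) (auto simp: ortho_family_def)
  finally show ?thesis .
qed

lemma norm_square_ortho_split:
  assumes "ortho_family e J" "finite J"
  shows "(norm x)\<^sup>2 = (\<Sum>j\<in>J. (cmod (cinner x (e j)))\<^sup>2) + (norm (x - ortho_proj e J x))\<^sup>2"
proof -
  have "cinner (x - ortho_proj e J x) (ortho_proj e J x) = 0"
    unfolding ortho_proj_def[of e J x, unfolded] cinner_sum_right cinner_scaleC_right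
    using cinner_ortho_proj_rest[OF assms, of _ x] by (simp add: ortho_proj_def)
  from norm_add_square_orthogonal[OF this] norm_ortho_proj[OF assms]
  show ?thesis by simp
qed

lemma Bessel:
  assumes "ortho_family e J" "finite J"
  shows "(\<Sum>j\<in>J. (cmod (cinner x (e j)))\<^sup>2) \<le> (norm x)\<^sup>2"
  using norm_square_ortho_split[OF assms, of x] by simp

lemma norm_ortho_proj_rest:
  assumes "ortho_family e J" "finite J"
  shows "norm (x - ortho_proj e J x) \<le> norm x"
proof -
  have "(norm (x - ortho_proj e J x))\<^sup>2 \<le> (norm x)\<^sup>2"
    using norm_square_ortho_split[OF assms, of x] by (simp add: sum_nonneg)
  then show ?thesis by (rule power2_le_imp_le) simp
qed

section \<open>Complex-linear operators, rank-one operators and the product space\<close>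

lemma blinfun_scaleC: "a \<in> bounded_ops \<Longrightarrow> blinfun_apply a (c *\<^sub>C x) = c *\<^sub>C blinfun_apply a x"
  by (simp add: bounded_ops_def)

lemma bounded_ops_add: "a \<in> bounded_ops \<Longrightarrow> b \<in> bounded_ops \<Longrightarrow> a + b \<in> bounded_ops"
  by (simp add: bounded_ops_def blinfun.add_left scaleC_add_right)

lemma bounded_ops_minus: "a \<in> bounded_ops \<Longrightarrow> - a \<in> bounded_ops"
  by (simp add: bounded_ops_def blinfun.minus_left complex_vector.scale_minus_right)

lemma bounded_ops_zero [simp]: "0 \<in> bounded_ops"
  by (simp add: bounded_ops_def)

lemma bounded_ops_sum: "(\<And>i. i \<in> J \<Longrightarrow> f i \<in> bounded_ops) \<Longrightarrow> sum f J \<in> bounded_ops"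
  by (induction J rule: infinite_finite_induct) (auto intro: bounded_ops_add)

lift_definition rank_one :: "'a::complex_hilbert \<Rightarrow> 'a \<Rightarrow> 'a \<Rightarrow>\<^sub>L 'a" is
  "\<lambda>f e x. cinner x e *\<^sub>C f"
proof -
  fix f e :: 'a
  show "bounded_linear (\<lambda>x. cinner x e *\<^sub>C f)"
  proof (rule bounded_linear_intro[where K = "norm e * norm f"])
    fix x y :: 'a and r :: real
    show "cinner (x + y) e *\<^sub>C f = cinner x e *\<^sub>C f + cinner y e *\<^sub>C f"
      by (simp add: cinner_simps scaleC_add_left)
    show "cinner (r *\<^sub>R x) e *\<^sub>C f = r *\<^sub>R (cinner x e *\<^sub>C f)"
      by (simp add: cinner_simps scaleR_eq_scaleC scaleC_scaleC)
    show "norm (cinner x e *\<^sub>C f) \<le> norm x * (norm e * norm f)"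
      using mult_right_mono[OF Cauchy_Schwarz_cinner[of x e], of "norm f"] by (simp add: mult_ac)
  qed
qed

declare rank_one.rep_eq [simp]

lemma rank_one_bounded_ops [simp]: "rank_one f e \<in> bounded_ops"
  by (simp add: bounded_ops_def cinner_simps scaleC_scaleC)

text \<open>The self-adjoint dilations of operators on \<open>'a\<close> act on this
  product.\<close>

instantiation prod :: (complex_hilbert, complex_hilbert) complex_hilbert
begin

definition scaleC_prod :: "complex \<Rightarrow> 'a \<times> 'b \<Rightarrow> 'a \<times> 'b" where
  "scaleC_prod c x = (c *\<^sub>C fst x, c *\<^sub>C snd x)"

definition cinner_prod :: "'a \<times> 'b \<Rightarrow> 'a \<times> 'b \<Rightarrow> complex" where
  "cinner_prod x y = cinner (fst x) (fst y) + cinner (snd x) (snd y)"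

instance
  by standard
    (auto simp: scaleC_prod_def cinner_prod_def scaleC_add_right scaleC_add_left scaleC_scaleC
      scaleC_one scaleR_eq_scaleC cinner_simps cinner_self norm_prod_def algebra_simps
      prod_eq_iff cinner_commute[symmetric])

end

section \<open>Approximation numbers and compact operators\<close>

text \<open>Gaussian elimination, by induction on the set of equations. It carries the dimension
  counts behind the lower bounds for approximation numbers and behind the comparison of sizes of
  orthonormal systems.\<close>

lemma homogeneous_system_nontrivial_solution:
  fixes A :: "'i \<Rightarrow> 'j \<Rightarrow> complex"
  assumes "finite I" "finite J" "card I < card J"
  shows "\<exists>c. (\<exists>j\<in>J. c j \<noteq> 0) \<and> (\<forall>i\<in>I. (\<Sum>j\<in>J. A i j * c j) = 0)"
  using assms
proof (induction I arbitrary: J A rule: finite_induct)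
  case empty
  then obtain j where "j \<in> J" by (metis card.empty equals0I less_irrefl)
  then show ?case by (intro exI[of _ "\<lambda>_. 1"]) auto
next
  case (insert i0 I)
  show ?case
  proof (cases "\<forall>j\<in>J. A i0 j = 0")
    case True
    have "card I < card J" using insert by simp
    from insert.IH[OF \<open>finite J\<close> this, of A] obtain c where
      "\<exists>j\<in>J. c j \<noteq> 0" "\<forall>i\<in>I. (\<Sum>j\<in>J. A i j * c j) = 0" by blast
    with True show ?thesis by (intro exI[of _ c]) auto
  next
    case False
    then obtain j0 where j0: "j0 \<in> J" "A i0 j0 \<noteq> 0" by blast
    define J' where "J' = J - {j0}"
    have J': "finite J'" "card I < card J'" using insert j0 by (auto simp: J'_def)
    \<comment> \<open>Equation \<open>i0\<close> with pivot \<open>j0\<close> eliminates the unknown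
      \<open>j0\<close> from all other equations.\<close>
    define A' where "A' i j = A i j - A i j0 * A i0 j / A i0 j0" for i j
    from insert.IH[OF J', of A'] obtain c where
      c: "\<exists>j\<in>J'. c j \<noteq> 0" "\<And>i. i \<in> I \<Longrightarrow> (\<Sum>j\<in>J'. A' i j * c j) = 0" by blast
    define S where "S = (\<Sum>j\<in>J'. A i0 j * c j)"
    \<comment> \<open>Back substitution: the value at \<open>j0\<close> is the one that solves
      equation \<open>i0\<close>.\<close>
    define d where "d j = (if j = j0 then - S / A i0 j0 else c j)" for j
    have sum_d: "(\<Sum>j\<in>J. A i j * d j) = - A i j0 * S / A i0 j0 + (\<Sum>j\<in>J'. A i j * c j)" for i
    proof -
      have "(\<Sum>j\<in>J. A i j * d j) = A i j0 * d j0 + (\<Sum>j\<in>J'. A i j * d j)"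
        unfolding J'_def by (rule sum.remove) (use insert j0 in auto)
      moreover have "(\<Sum>j\<in>J'. A i j * d j) = (\<Sum>j\<in>J'. A i j * c j)"
        by (intro sum.cong) (auto simp: d_def J'_def)
      ultimately show ?thesis by (simp add: d_def)
    qed
    have "(\<Sum>j\<in>J. A i j * d j) = 0" if "i \<in> I" for i
    proof -
      have "(\<Sum>j\<in>J'. A' i j * c j) = (\<Sum>j\<in>J'. A i j * c j) - A i j0 / A i0 j0 * S"
        unfolding A'_def S_def sum_distrib_left sum_subtractf[symmetric]
        by (intro sum.cong) (auto simp: algebra_simps)
      with c(2)[OF that] sum_d[of i] show ?thesis by simp
    qed
    moreover have "(\<Sum>j\<in>J. A i0 j * d j) = 0"
      using sum_d[of i0] j0 by (simp add: S_def[symmetric])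
    moreover have "\<exists>j\<in>J. d j \<noteq> 0" using c(1) by (auto simp: d_def J'_def)
    ultimately show ?thesis by (intro exI[of _ d]) auto
  qed
qed

lemma approx_number_le:
  assumes "f \<in> bounded_ops" "finite B" "card B \<le> n" "range (blinfun_apply f) \<subseteq> cspan B"
  shows "approx_number a n \<le> norm (a - f)"
  unfolding approx_number_def
  by (rule cINF_lower) (use assms in \<open>auto intro!: bdd_belowI[of _ 0]\<close>)

lemma approx_number_greatest:
  assumes "\<And>f B. f \<in> bounded_ops \<Longrightarrow> finite B \<Longrightarrow> card B \<le> n \<Longrightarrow> range (blinfun_apply f) \<subseteq> cspan B
    \<Longrightarrow> C \<le> norm (a - f)"
  shows "C \<le> approx_number a n"
  unfolding approx_number_def
proof (rule cINF_greatest)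
  have "0 \<in> cspan B" for B :: "'a set" by (rule complex_vector.span_zero)
  then show "{f \<in> bounded_ops. \<exists>B. finite B \<and> card B \<le> n \<and> range (blinfun_apply f) \<subseteq> cspan B} \<noteq> {}"
    by (auto intro!: exI[of _ 0] exI[of _ "{}"])
qed (use assms in blast)

lemma approx_number_nonneg: "0 \<le> approx_number a n"
  by (rule approx_number_greatest) simp

lemma approx_number_Lipschitz: "approx_number a n \<le> approx_number b n + norm (a - b)"
proof -
  have "approx_number a n - norm (a - b) \<le> approx_number b n"
  proof (rule approx_number_greatest)
    fix f :: "'a \<Rightarrow>\<^sub>L 'a" and B
    assume "f \<in> bounded_ops" "finite B" "card B \<le> n" "range (blinfun_apply f) \<subseteq> cspan B"
    then have "approx_number a n \<le> norm (a - f)" by (rule approx_number_le)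
    also have "\<dots> \<le> norm (a - b) + norm (b - f)" using norm_triangle_ineq[of "a - b" "b - f"] by simp
    finally show "approx_number a n - norm (a - b) \<le> norm (b - f)" by simp
  qed
  then show ?thesis by simp
qed

lemma abs_approx_number_diff: "\<bar>approx_number a n - approx_number b n\<bar> \<le> norm (a - b)"
  using approx_number_Lipschitz[of a n b] approx_number_Lipschitz[of b n a] by (simp add: norm_minus_commute)

lemma blinfun_sum_scaleC:
  "f \<in> bounded_ops \<Longrightarrow>
    blinfun_apply f (\<Sum>j\<in>J. c j *\<^sub>C x j) = (\<Sum>j\<in>J. c j *\<^sub>C blinfun_apply f (x j))"
  by (simp add: blinfun.sum_right blinfun_scaleC)

text \<open>An operator of rank at most \<open>n\<close> together with the constraints given by \<open>I\<close> annihilates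
  a nontrivial combination of the vectors \<open>x j\<close>.\<close>

lemma approx_number_ge:
  fixes T :: "'a::complex_hilbert \<Rightarrow>\<^sub>L 'a"
  assumes fin: "finite J" "finite I" and card: "n + card I < card J"
    and lower: "\<And>c v. \<lbrakk>\<exists>j\<in>J. c j \<noteq> 0; v = (\<Sum>j\<in>J. c j *\<^sub>C x j); \<And>i. i \<in> I \<Longrightarrow> cinner v (w i) = 0\<rbrakk>
      \<Longrightarrow> v \<noteq> 0 \<and> C * norm v \<le> norm (blinfun_apply T v)"
  shows "C \<le> approx_number T n"
proof (rule approx_number_greatest)
  fix f :: "'a \<Rightarrow>\<^sub>L 'a" and B
  assume f: "f \<in> bounded_ops" and B: "finite B" "card B \<le> n" and range: "range (blinfun_apply f) \<subseteq> cspan B"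
  have "\<exists>A. blinfun_apply f (x j) = (\<Sum>b\<in>B. A b *\<^sub>C b)" for j
    using range complex_vector.span_finite[OF B(1)] by auto
  then obtain A where A: "\<And>j. blinfun_apply f (x j) = (\<Sum>b\<in>B. A j b *\<^sub>C b)" by metis
  define M where "M i j = (case i of Inl b \<Rightarrow> A j b | Inr i \<Rightarrow> cinner (x j) (w i))" for i j
  have "card (B <+> I) < card J" using card B by (simp add: card_Plus fin)
  from homogeneous_system_nontrivial_solution[OF _ fin(1) this, of M] B fin
  obtain c where c: "\<exists>j\<in>J. c j \<noteq> 0" "\<And>i. i \<in> B <+> I \<Longrightarrow> (\<Sum>j\<in>J. M i j * c j) = 0" by auto
  define v where "v = (\<Sum>j\<in>J. c j *\<^sub>C x j)"
  have "cinner v (w i) = 0" if "i \<in> I" for i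
    using c(2)[OF InrI[OF that]] by (simp add: M_def v_def cinner_sum_left cinner_simps mult.commute)
  with c(1) have v: "v \<noteq> 0" "C * norm v \<le> norm (blinfun_apply T v)"
    using lower[of c v] v_def by auto
  have "blinfun_apply f v = (\<Sum>j\<in>J. \<Sum>b\<in>B. (c j * A j b) *\<^sub>C b)"
    by (simp add: v_def blinfun_sum_scaleC f A complex_vector.scale_sum_right scaleC_scaleC)
  also have "\<dots> = (\<Sum>b\<in>B. (\<Sum>j\<in>J. c j * A j b) *\<^sub>C b)"
    by (subst sum.swap) (simp add: complex_vector.scale_sum_left)
  also have "\<dots> = 0"
    using c(2)[of "Inl b" for b] by (intro sum.neutral) (auto simp: M_def mult.commute)
  finally have "C * norm v \<le> norm (blinfun_apply (T - f) v)"
    using v by (simp add: blinfun.diff_left)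
  also have "\<dots> \<le> norm (T - f) * norm v" by (rule norm_blinfun)
  finally show "C \<le> norm (T - f)" using v(1) by simp
qed

lemma ortho_combination_nonzero:
  fixes x :: "'i \<Rightarrow> 'a::complex_hilbert"
  assumes "finite J" "\<And>i j. i \<in> J \<Longrightarrow> j \<in> J \<Longrightarrow> i \<noteq> j \<Longrightarrow> cinner (x i) (x j) = 0"
    and "\<And>j. j \<in> J \<Longrightarrow> x j \<noteq> 0" and "\<exists>j\<in>J. c j \<noteq> 0"
  shows "(\<Sum>j\<in>J. c j *\<^sub>C x j) \<noteq> 0"
proof
  assume "(\<Sum>j\<in>J. c j *\<^sub>C x j) = 0"
  then have "(\<Sum>j\<in>J. (cmod (c j))\<^sup>2 * (norm (x j))\<^sup>2) = 0"
    using norm_sum_square_orthogonal[of J x c] assms(1,2) by simp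
  then show False using assms by (subst (asm) sum_nonneg_eq_0_iff) auto
qed

section \<open>Compact operators and vectors at which they attain their norm\<close>

lemma compact_opsI:
  assumes "a \<in> bounded_ops" "blinfun_apply a ` cball 0 1 \<subseteq> K" "compact K"
  shows "a \<in> compact_ops"
proof -
  have "closure (blinfun_apply a ` cball 0 1) \<subseteq> K"
    using assms by (simp add: closure_minimal compact_imp_closed)
  then have "closure (blinfun_apply a ` cball 0 1) = K \<inter> closure (blinfun_apply a ` cball 0 1)" by blast
  then have "compact (closure (blinfun_apply a ` cball 0 1))"
    using compact_Int_closed[OF assms(3) closed_closure] by metis
  with assms show ?thesis by (simp add: compact_ops_def)
qed

lemma compact_ops_bounded: "a \<in> compact_ops \<Longrightarrow> a \<in> bounded_ops"
  by (simp add: compact_ops_def)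

lemma compact_ops_image:
  assumes "a \<in> compact_ops"
  obtains K where "compact K" "blinfun_apply a ` cball 0 1 \<subseteq> K"
  using that[OF _ closure_subset] assms by (simp add: compact_ops_def)

lemma compact_ops_add:
  assumes "a \<in> compact_ops" "b \<in> compact_ops" shows "a + b \<in> compact_ops"
proof -
  obtain K L where K: "compact K" "blinfun_apply a ` cball 0 1 \<subseteq> K"
    and L: "compact L" "blinfun_apply b ` cball 0 1 \<subseteq> L"
    using assms compact_ops_image by metis
  show ?thesis
  proof (rule compact_opsI[OF _ _ compact_sums[OF K(1) L(1)]])
    show "a + b \<in> bounded_ops" using assms by (simp add: bounded_ops_add compact_ops_bounded)
    show "blinfun_apply (a + b) ` cball 0 1 \<subseteq> {x + y |x y. x \<in> K \<and> y \<in> L}"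
      using K(2) L(2) unfolding image_subset_iff blinfun.add_left by blast
  qed
qed

lemma compact_ops_minus:
  assumes "a \<in> compact_ops" shows "- a \<in> compact_ops"
proof -
  obtain K where K: "compact K" "blinfun_apply a ` cball 0 1 \<subseteq> K"
    using assms compact_ops_image by metis
  show ?thesis
    by (rule compact_opsI[OF _ _ compact_negations[OF K(1)]])
      (use assms K in \<open>auto simp: bounded_ops_minus compact_ops_bounded blinfun.minus_left\<close>)
qed

lemma compact_ops_diff: "a \<in> compact_ops \<Longrightarrow> b \<in> compact_ops \<Longrightarrow> a - b \<in> compact_ops"
  using compact_ops_add[OF _ compact_ops_minus] by fastforce

lemma rank_one_compact_ops: "rank_one f e \<in> compact_ops"
proof (rule compact_opsI)
  have "continuous_on (cball 0 (norm e)) (\<lambda>z. z *\<^sub>C f)"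
  proof (rule linear_continuous_on)
    show "bounded_linear (\<lambda>z. z *\<^sub>C f)"
      by (rule bounded_linear_intro[where K = "norm f"])
        (simp_all add: scaleC_add_left scaleR_eq_scaleC scaleC_scaleC scaleC_complex_def)
  qed
  then show "compact ((\<lambda>z. z *\<^sub>C f) ` cball 0 (norm e))"
    by (rule compact_continuous_image) simp
  have "cmod (cinner x e) \<le> norm e" if "norm x \<le> 1" for x
    using Cauchy_Schwarz_cinner[of x e] mult_right_mono[OF that, of "norm e"] by simp
  then show "blinfun_apply (rank_one f e) ` cball 0 1 \<subseteq> (\<lambda>z. z *\<^sub>C f) ` cball 0 (norm e)"
    by auto
qed simp

lemma compact_ops_zero: "0 \<in> compact_ops"
  by (rule compact_opsI[where K = "{0}"]) auto

lemma compact_ops_sum: "(\<And>i. i \<in> J \<Longrightarrow> f i \<in> compact_ops) \<Longrightarrow> sum f J \<in> compact_ops"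
  by (induction J rule: infinite_finite_induct) (auto intro: compact_ops_add compact_ops_zero)

lemma compact_ops_subsequence:
  assumes "a \<in> compact_ops" "\<And>n::nat. norm (x n) \<le> 1"
  obtains l r where "strict_mono r" "(\<lambda>n. blinfun_apply a (x (r n))) \<longlonglongrightarrow> l"
proof -
  obtain K where K: "compact K" "blinfun_apply a ` cball 0 1 \<subseteq> K"
    using assms compact_ops_image by metis
  have "\<forall>n. blinfun_apply a (x n) \<in> K" using assms K by auto
  with K(1) show ?thesis
    using that by (auto simp: compact_eq_seq_compact_metric seq_compact_def o_def dest!: spec[of _ "\<lambda>n. blinfun_apply a (x n)"])
qed

text \<open>Compactness makes the images of a maximising sequence converge along a subsequence. The
  vectors themselves then converge too: if the images of \<open>y\<close> and \<open>z\<close> are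
  both close to a limit of norm \<open>M\<close>, then \<open>y + z\<close> has norm close to 2, and
  the parallelogram law forces \<open>y - z\<close> to be small. No weak compactness is involved.
  The zero vector is returned exactly when the operator vanishes on \<open>C\<close>.\<close>

lemma compact_op_attains_norm:
  fixes a :: "'a::complex_hilbert \<Rightarrow>\<^sub>L 'a"
  assumes a: "a \<in> compact_ops" and C: "closed C" "0 \<in> C"
    and add: "\<And>x y. x \<in> C \<Longrightarrow> y \<in> C \<Longrightarrow> x + y \<in> C"
    and scale: "\<And>r x. x \<in> C \<Longrightarrow> r *\<^sub>R x \<in> C"
  shows "\<exists>x\<in>C. (if blinfun_apply a x = 0 then x = 0 else norm x = 1) \<and>
    (\<forall>z\<in>C. norm (blinfun_apply a z) \<le> norm (blinfun_apply a x) * norm z)"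
proof -
  define S where "S = (\<lambda>x. norm (blinfun_apply a x)) ` (C \<inter> cball 0 1)"
  define M where "M = Sup S"
  have "norm (blinfun_apply a x) \<le> norm a" if "norm x \<le> 1" for x
    using norm_blinfun[of a x] mult_left_mono[OF that, of "norm a"] by simp
  then have bdd: "bdd_above S" by (auto simp: S_def intro!: bdd_aboveI[of _ "norm a"])
  have "0 \<in> S" using C by (auto simp: S_def image_iff intro!: bexI[of _ 0])
  then have M0: "0 \<le> M" unfolding M_def using bdd by (simp add: cSup_upper)
  have M1: "norm (blinfun_apply a z) \<le> M" if "z \<in> C" "norm z \<le> 1" for z
    unfolding M_def using that by (intro cSup_upper bdd) (auto simp: S_def)
  have M: "norm (blinfun_apply a z) \<le> M * norm z" if "z \<in> C" for z
  proof (cases "z = 0")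
    case False
    have "norm (blinfun_apply a ((1 / norm z) *\<^sub>R z)) \<le> M"
      using that False by (intro M1 scale) auto
    with False show ?thesis by (simp add: blinfun.scaleR_right field_simps)
  qed simp
  show ?thesis
  proof (cases "M = 0")
    case True
    with M show ?thesis by (intro bexI[of _ 0] conjI ballI) (auto simp: C)
  next
    case False
    with M0 have Mpos: "M > 0" by simp
    have "\<exists>x\<in>C. norm x \<le> 1 \<and> M - 1 / Suc n < norm (blinfun_apply a x)" for n
    proof -
      have "M - 1 / Suc n < Sup S" by (simp add: M_def)
      then obtain y where "y \<in> S" "M - 1 / Suc n < y"
        using less_cSup_iff[OF _ bdd] \<open>0 \<in> S\<close> by blast
      then show ?thesis by (auto simp: S_def)
    qed
    then obtain x where x: "\<And>n. x n \<in> C" "\<And>n. norm (x n) \<le> 1"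
      "\<And>n. M - 1 / Suc n < norm (blinfun_apply a (x n))" by metis
    obtain l r where r: "strict_mono r" and l: "(\<lambda>n. blinfun_apply a (x (r n))) \<longlonglongrightarrow> l"
      using compact_ops_subsequence[of a x] a x(2) by blast
    have "(\<lambda>n. norm (blinfun_apply a (x n))) \<longlonglongrightarrow> M"
    proof (rule tendsto_sandwich[of "\<lambda>n. M - 1 / Suc n" _ _ "\<lambda>_. M"])
      show "(\<lambda>n. M - 1 / Suc n) \<longlonglongrightarrow> M"
        using tendsto_diff[OF tendsto_const LIMSEQ_inverse_real_of_nat, of M] by (simp add: inverse_eq_divide)
    qed (use x M1 in \<open>auto intro!: always_eventually less_imp_le\<close>)
    then have "(\<lambda>n. norm (blinfun_apply a (x (r n)))) \<longlonglongrightarrow> M"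
      using LIMSEQ_subseq_LIMSEQ[OF _ r] by (force simp: o_def)
    with tendsto_norm[OF l] have lM: "norm l = M" by (rule LIMSEQ_unique)
    have "Cauchy (\<lambda>n. x (r n))"
    proof (rule metric_CauchyI)
      fix e :: real assume e: "e > 0"
      \<comment> \<open>The bound by \<open>M\<close> keeps \<open>2 * (M - d)\<close> nonnegative,
        so that it may be squared; the other bound makes the resulting error
        \<open>8 * M * d - 4 * d\<^sup>2\<close> smaller than
        \<open>M\<^sup>2 * e\<^sup>2\<close>.\<close>
      define d where "d = min M (M * e\<^sup>2 / 16)"
      have d: "d > 0" "d \<le> M" "16 * d \<le> M * e\<^sup>2" using Mpos e by (auto simp: d_def)
      from l d(1) obtain N where N: "\<And>n. n \<ge> N \<Longrightarrow> dist (blinfun_apply a (x (r n))) l < d"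
        by (meson lim_sequentially)
      have "dist (x (r m)) (x (r n)) < e" if "m \<ge> N" "n \<ge> N" for m n
      proof -
        define y z where "y = x (r m)" and "z = x (r n)"
        have yz: "y \<in> C" "z \<in> C" "norm y \<le> 1" "norm z \<le> 1" using x by (auto simp: y_def z_def)
        have "2 *\<^sub>R l = blinfun_apply a (y + z) - ((blinfun_apply a y - l) + (blinfun_apply a z - l))"
          by (simp add: blinfun.add_right scaleR_2)
        then have "norm (2 *\<^sub>R l) \<le> norm (blinfun_apply a (y + z)) + norm ((blinfun_apply a y - l) + (blinfun_apply a z - l))"
          by (metis norm_triangle_ineq4)
        also have "\<dots> \<le> M * norm (y + z) + (d + d)"
          using N[OF that(1)] N[OF that(2)] M[OF add[OF yz(1,2)]] norm_triangle_ineq[of "blinfun_apply a y - l" "blinfun_apply a z - l"]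
          unfolding y_def[symmetric] z_def[symmetric] dist_norm by linarith
        finally have *: "2 * (M - d) \<le> M * norm (y + z)" using lM by simp
        have "(2 * (M - d))\<^sup>2 \<le> (M * norm (y + z))\<^sup>2"
          by (rule power_mono[OF *]) (use d in simp)
        moreover have "(norm (y + z))\<^sup>2 + (norm (y - z))\<^sup>2 \<le> 4"
          using parallelogram[of y z] yz power_mono[of "norm y" 1 2] power_mono[of "norm z" 1 2] by simp
        then have "M\<^sup>2 * ((norm (y + z))\<^sup>2 + (norm (y - z))\<^sup>2) \<le> M\<^sup>2 * 4"
          by (rule mult_left_mono) simp
        ultimately have "M\<^sup>2 * (norm (y - z))\<^sup>2 \<le> 8 * M * d - 4 * d\<^sup>2"
          by (simp add: power2_eq_square algebra_simps)
        also have "\<dots> < M * (16 * d)" using mult_pos_pos[OF Mpos d(1)] zero_le_power2[of d] by linarith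
        also have "\<dots> \<le> M * (M * e\<^sup>2)" using d Mpos by (intro mult_left_mono) auto
        finally have "M\<^sup>2 * (norm (y - z))\<^sup>2 < M\<^sup>2 * e\<^sup>2" by (simp add: power2_eq_square)
        then have "(norm (y - z))\<^sup>2 < e\<^sup>2" using Mpos by simp
        then show ?thesis
          unfolding dist_norm y_def[symmetric] z_def[symmetric] using e by (simp add: power2_less_imp_less)
      qed
      then show "\<exists>N. \<forall>m\<ge>N. \<forall>n\<ge>N. dist (x (r m)) (x (r n)) < e" by blast
    qed
    then obtain y where y: "(\<lambda>n. x (r n)) \<longlonglongrightarrow> y" by (auto simp: Cauchy_convergent_iff convergent_def)
    have "y \<in> C" using C(1) y x(1) by (meson closed_sequentially)
    have "norm y \<le> 1" using tendsto_norm[OF y] x(2) by (intro LIMSEQ_le_const2[of _ _ 1]) auto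
    have "(\<lambda>n. blinfun_apply a (x (r n))) \<longlonglongrightarrow> blinfun_apply a y"
      using y by (rule blinfun.tendsto[OF tendsto_const])
    with l have al: "blinfun_apply a y = l" using LIMSEQ_unique by blast
    with lM M[OF \<open>y \<in> C\<close>] Mpos have "norm y \<ge> 1" by simp
    with \<open>norm y \<le> 1\<close> have "norm y = 1" by simp
    with al lM Mpos M \<open>y \<in> C\<close> show ?thesis by (intro bexI[of _ y]) auto
  qed
qed

section \<open>Schmidt decomposition\<close>

text \<open>The \<open>e i\<close> are right singular vectors, with \<open>e i = 0\<close> once
  \<open>s i = 0\<close>. The field \<open>image_inner\<close> says that \<open>e i\<close> is an
  eigenvector of the adjoint times \<open>a\<close> for the eigenvalue \<open>(s i)\<^sup>2\<close>,
  phrased without the adjoint because its existence is derived from these data. The field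
  \<open>bound\<close> says that \<open>s n\<close> bounds \<open>a\<close> on the complement of the
  first \<open>n\<close> vectors.\<close>

locale schmidt_system =
  fixes a :: "'a::complex_hilbert \<Rightarrow>\<^sub>L 'a" and e :: "nat \<Rightarrow> 'a" and s :: "nat \<Rightarrow> real"
  assumes bounded: "a \<in> bounded_ops"
    and decseq: "decseq s"
    and nonneg: "0 \<le> s n"
    and lim: "s \<longlonglongrightarrow> 0"
    and inner: "cinner (e i) (e j) = (if i = j \<and> 0 < s i then 1 else 0)"
    and image_inner: "cinner (blinfun_apply a (e i)) (blinfun_apply a z) = complex_of_real ((s i)\<^sup>2) * cinner (e i) z"
    and bound: "(\<And>j. j < n \<Longrightarrow> cinner z (e j) = 0) \<Longrightarrow> norm (blinfun_apply a z) \<le> s n * norm z"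

text \<open>First variation at a maximum: moving \<open>x\<close> in the direction \<open>z\<close>
  changes the squared norm of the image to first order by the inner product of the two images,
  whereas orthogonality makes the squared norm of the vector itself change only to second
  order.\<close>

lemma maximizer_image_orthogonal:
  fixes a :: "'a::complex_hilbert \<Rightarrow>\<^sub>L 'a"
  assumes a: "a \<in> bounded_ops" and x: "norm x = 1" and orth: "cinner x z = 0"
    and max: "\<And>c. norm (blinfun_apply a (x + c *\<^sub>C z)) \<le> norm (blinfun_apply a x) * norm (x + c *\<^sub>C z)"
  shows "cinner (blinfun_apply a x) (blinfun_apply a z) = 0"
proof -
  define w where "w = cinner (blinfun_apply a x) (blinfun_apply a z)"
  define M where "M = norm (blinfun_apply a x)"
  \<comment> \<open>With this step length the second-order term is at most
    \<open>t * (cmod w)\<^sup>2\<close>, half of the first-order gain. The summand 1 covers a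
    vanishing denominator.\<close>
  define t where "t = 1 / (M\<^sup>2 * (norm z)\<^sup>2 + 1)"
  have den: "M\<^sup>2 * (norm z)\<^sup>2 + 1 > 0" by (simp add: add_nonneg_pos)
  then have t: "t > 0" "t * (M\<^sup>2 * (norm z)\<^sup>2) \<le> 1" by (auto simp: t_def field_simps)
  define c where "c = complex_of_real t * w"
  have c2: "(cmod c)\<^sup>2 = t\<^sup>2 * (cmod w)\<^sup>2" using t by (simp add: c_def norm_mult power_mult_distrib)
  have "(norm (blinfun_apply a (x + c *\<^sub>C z)))\<^sup>2 \<le> (M * norm (x + c *\<^sub>C z))\<^sup>2"
    unfolding M_def by (rule power_mono[OF max]) simp
  also have "\<dots> = M\<^sup>2 * (1 + (cmod c)\<^sup>2 * (norm z)\<^sup>2)"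
    using x orth by (simp add: power_mult_distrib norm_add_square cinner_simps)
  also have "(norm (blinfun_apply a (x + c *\<^sub>C z)))\<^sup>2
      = M\<^sup>2 + 2 * Re (cnj c * w) + (cmod c)\<^sup>2 * (norm (blinfun_apply a z))\<^sup>2"
    by (simp add: blinfun.add_right blinfun_scaleC a norm_add_square cinner_simps M_def w_def power_mult_distrib)
  also have "Re (cnj c * w) = t * (cmod w)\<^sup>2"
    unfolding c_def by (simp add: cmod_power2) (simp add: power2_eq_square algebra_simps)
  finally have "2 * (t * (cmod w)\<^sup>2) + (cmod c)\<^sup>2 * (norm (blinfun_apply a z))\<^sup>2
      \<le> M\<^sup>2 * ((cmod c)\<^sup>2 * (norm z)\<^sup>2)" by (simp add: algebra_simps)
  moreover have "0 \<le> (cmod c)\<^sup>2 * (norm (blinfun_apply a z))\<^sup>2" by simp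
  moreover have "M\<^sup>2 * ((cmod c)\<^sup>2 * (norm z)\<^sup>2) = (t * (cmod w)\<^sup>2) * (t * (M\<^sup>2 * (norm z)\<^sup>2))"
    unfolding c2 by (simp add: power2_eq_square)
  moreover have "\<dots> \<le> (t * (cmod w)\<^sup>2) * 1" using t by (intro mult_left_mono) auto
  ultimately have "t * (cmod w)\<^sup>2 \<le> 0" by linarith
  then have "(cmod w)\<^sup>2 \<le> 0" using t by (simp add: mult_le_0_iff)
  then show ?thesis by (simp add: w_def)
qed

text \<open>Greedy construction: \<open>e n\<close> maximises the norm of the image among unit
  vectors orthogonal to its predecessors, and \<open>s n\<close> is the maximum.\<close>

lemma schmidt_system_exists:
  fixes a :: "'a::complex_hilbert \<Rightarrow>\<^sub>L 'a"
  assumes a: "a \<in> compact_ops"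
  obtains e s where "schmidt_system a e s"
proof -
  have ab: "a \<in> bounded_ops" using a by (rule compact_ops_bounded)
  define C where "C f n = {x. \<forall>j\<in>{..<n}. cinner x (f j) = 0}" for f :: "nat \<Rightarrow> 'a" and n
  define P where "P f n r \<longleftrightarrow> r \<in> C f n \<and> (if blinfun_apply a r = 0 then r = 0 else norm r = 1) \<and>
    (\<forall>z\<in>C f n. norm (blinfun_apply a z) \<le> norm (blinfun_apply a r) * norm z)" for f n r
  have "\<exists>e. \<forall>n. P e n (e n)"
  \<comment> \<open>The set of candidates for \<open>e n\<close> depends on all earlier choices,
    hence dependent choice along the order of the indices.\<close>
  proof (rule dependent_wellorder_choice)
    fix r :: 'a and f g :: "nat \<Rightarrow> 'a" and n :: nat
    assume "\<And>m. m < n \<Longrightarrow> f m = g m"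
    then have "C f n = C g n" by (auto simp: C_def)
    then show "P f n r = P g n r" by (simp add: P_def)
  next
    fix n and f :: "nat \<Rightarrow> 'a"
    have "\<exists>x\<in>C f n. (if blinfun_apply a x = 0 then x = 0 else norm x = 1) \<and>
      (\<forall>z\<in>C f n. norm (blinfun_apply a z) \<le> norm (blinfun_apply a x) * norm z)"
      by (rule compact_op_attains_norm[OF a])
        (auto simp: C_def cinner_simps closed_orthogonal)
    then show "\<exists>r. P f n r" by (auto simp: P_def)
  qed
  then obtain e where e: "\<And>n. P e n (e n)" by blast
  define s where "s n = norm (blinfun_apply a (e n))" for n
  have max: "norm (blinfun_apply a z) \<le> s n * norm z" if "\<And>j. j < n \<Longrightarrow> cinner z (e j) = 0" for n z
    using e[of n] that by (auto simp: P_def s_def C_def)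
  have below: "cinner (e i) (e j) = 0" if "j < i" for i j
    using e[of i] that by (auto simp: P_def C_def)
  have orth: "cinner (e i) (e j) = 0" if "i \<noteq> j" for i j
    using below[of i j] below[of j i] that cinner_commute[of "e i" "e j"] by (cases "i < j") auto
  have norm_e: "norm (e i) = (if 0 < s i then 1 else 0)" for i
    using e[of i] by (auto simp: P_def s_def)
  have dec: "decseq s"
  proof (rule decseq_SucI)
    fix n
    have "s (Suc n) \<le> s n * norm (e (Suc n))"
      unfolding s_def[of "Suc n"] by (rule max) (simp add: below)
    also have "\<dots> \<le> s n * 1" by (intro mult_left_mono) (auto simp: norm_e s_def)
    finally show "s (Suc n) \<le> s n" by simp
  qed
  \<comment> \<open>A vector \<open>z\<close> orthogonal to \<open>e j\<close> for all
    \<open>j \<le> i\<close> stays in the set on which \<open>e i\<close> was chosen as maximiser,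
    so the first-variation argument applies to it.\<close>
  have image_above: "cinner (blinfun_apply a (e i)) (blinfun_apply a z) = 0"
    if "\<And>j. j \<le> i \<Longrightarrow> cinner z (e j) = 0" for i z
  proof (cases "s i = 0")
    case True
    then show ?thesis by (simp add: s_def)
  next
    case False
    then have "norm (e i) = 1" using norm_e[of i] by (auto simp: s_def split: if_splits)
    moreover have "cinner (e i) z = 0" using that[of i] cinner_commute[of "e i" z] by simp
    ultimately show ?thesis
    proof (rule maximizer_image_orthogonal[OF ab])
      show "norm (blinfun_apply a (e i + c *\<^sub>C z)) \<le> norm (blinfun_apply a (e i)) * norm (e i + c *\<^sub>C z)" for c
        using that below[of _ i] by (fold s_def, intro max) (auto simp: cinner_simps)
    qed
  qed
  have image_orth: "cinner (blinfun_apply a (e i)) (blinfun_apply a (e j)) = 0" if "i \<noteq> j" for i j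
  proof -
    have *: "cinner (blinfun_apply a (e i)) (blinfun_apply a (e j)) = 0" if "i < j" for i j
      using that by (intro image_above) (simp add: below)
    show ?thesis
      using *[of i j] *[of j i] that cinner_commute[of "blinfun_apply a (e i)" "blinfun_apply a (e j)"]
      by (cases "i < j") auto
  qed
  have fam: "ortho_family e J" for J
    using orth norm_e by (auto simp: ortho_family_def)
  \<comment> \<open>Split \<open>z\<close> along the first \<open>Suc i\<close> vectors: the
    remainder is handled by \<open>image_above\<close>, and in the projection only the term
    \<open>j = i\<close> survives.\<close>
  have image: "cinner (blinfun_apply a (e i)) (blinfun_apply a z) = complex_of_real ((s i)\<^sup>2) * cinner (e i) z" for i z
  proof -
    define p where "p = ortho_proj e {..i} z"
    have "cinner (blinfun_apply a (e i)) (blinfun_apply a (z - p)) = 0"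
      unfolding p_def by (rule image_above) (simp add: cinner_ortho_proj_rest fam)
    moreover have "cinner (blinfun_apply a (e i)) (blinfun_apply a p)
        = (\<Sum>j\<in>{..i}. if j = i then complex_of_real ((s i)\<^sup>2) * cinner (e i) z else 0)"
      unfolding p_def ortho_proj_def blinfun_sum_scaleC[OF ab] cinner_sum_right cinner_scaleC_right
      by (intro sum.cong)
        (auto simp: image_orth cinner_self s_def cinner_commute[of "e i" z])
    ultimately show ?thesis by (simp add: blinfun.diff_right cinner_simps)
  qed
  have nonneg: "0 \<le> s n" for n by (simp add: s_def)
  have "s \<longlonglongrightarrow> 0"
  proof -
    obtain L where L: "s \<longlonglongrightarrow> L" "\<And>i. L \<le> s i"
      using decseq_convergent[OF dec, of 0] nonneg by blast
    have "L \<ge> 0" using LIMSEQ_le_const[OF L(1)] nonneg by auto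
    \<comment> \<open>Otherwise the images of the \<open>e n\<close> would be pairwise orthogonal of
      norm at least \<open>L\<close>, hence at mutual distance above \<open>L\<close>, and could
      have no convergent subsequence.\<close>
    moreover have "\<not> L > 0"
    proof
      assume pos: "L > 0"
      have "norm (e n) \<le> 1" for n by (simp add: norm_e)
      then obtain l r where r: "strict_mono r" and l: "(\<lambda>n. blinfun_apply a (e (r n))) \<longlonglongrightarrow> l"
        using compact_ops_subsequence[OF a] by blast
      have "Cauchy (\<lambda>n. blinfun_apply a (e (r n)))" using l by (rule LIMSEQ_imp_Cauchy)
      then obtain N where N: "\<And>m n. m \<ge> N \<Longrightarrow> n \<ge> N \<Longrightarrow>
          norm (blinfun_apply a (e (r m)) - blinfun_apply a (e (r n))) < L"
        using pos by (meson CauchyD)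
      have ne: "r N \<noteq> r (Suc N)" using r by (metis n_not_Suc_n strict_mono_eq)
      have "(norm (blinfun_apply a (e (r N)) - blinfun_apply a (e (r (Suc N)))))\<^sup>2 = (s (r N))\<^sup>2 + (s (r (Suc N)))\<^sup>2"
        unfolding norm_diff_square using image_orth[OF ne] by (simp add: s_def)
      moreover have "(norm (blinfun_apply a (e (r N)) - blinfun_apply a (e (r (Suc N)))))\<^sup>2 < L\<^sup>2"
        using N[of N "Suc N"] pos by (intro power_strict_mono) auto
      moreover have "L\<^sup>2 \<le> (s (r N))\<^sup>2" using L(2) pos by (intro power_mono) auto
      ultimately show False using zero_le_power2[of "s (r (Suc N))"] by linarith
    qed
    ultimately show ?thesis using L by simp
  qed
  moreover have "cinner (e i) (e j) = (if i = j \<and> 0 < s i then 1 else 0)" for i j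
    using orth[of i j] norm_e[of i] by (cases "i = j") (auto simp: cinner_self)
  ultimately have "schmidt_system a e s"
    using ab dec nonneg image by unfold_locales (auto intro: max)
  then show ?thesis by (rule that)
qed

section \<open>Diagonal operators and their norm limits\<close>

lemma norm_diagonal_op:
  assumes "finite J" "ortho_family e J" "ortho_family g J"
    and "\<And>j. j \<in> J \<Longrightarrow> \<bar>c j\<bar> \<le> C" "0 \<le> C"
  shows "norm (\<Sum>j\<in>J. rank_one (c j *\<^sub>R g j) (e j)) \<le> C"
proof (rule norm_blinfun_bound[OF assms(5)])
  fix x
  have "blinfun_apply (\<Sum>j\<in>J. rank_one (c j *\<^sub>R g j) (e j)) x
      = (\<Sum>j\<in>J. (complex_of_real (c j) * cinner x (e j)) *\<^sub>C g j)"
    by (simp add: blinfun.sum_left scaleR_eq_scaleC scaleC_scaleC mult.commute)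
  then have "(norm (blinfun_apply (\<Sum>j\<in>J. rank_one (c j *\<^sub>R g j) (e j)) x))\<^sup>2
      = (\<Sum>j\<in>J. (\<bar>c j\<bar> * cmod (cinner x (e j)))\<^sup>2 * (norm (g j))\<^sup>2)"
    using norm_sum_square_orthogonal[of J g] assms(1,3) by (simp add: ortho_family_def norm_mult)
  also have "\<dots> \<le> (\<Sum>j\<in>J. C\<^sup>2 * (cmod (cinner x (e j)))\<^sup>2)"
  proof (rule sum_mono)
    fix j assume j: "j \<in> J"
    have "(\<bar>c j\<bar> * cmod (cinner x (e j)))\<^sup>2 * (norm (g j))\<^sup>2 \<le> (\<bar>c j\<bar> * cmod (cinner x (e j)))\<^sup>2 * 1"
      using assms(3) j by (intro mult_left_mono) (auto simp: ortho_family_def)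
    also have "\<dots> \<le> (C * cmod (cinner x (e j)))\<^sup>2"
      using assms(4)[OF j] by (auto intro!: power_mono mult_right_mono)
    finally show "(\<bar>c j\<bar> * cmod (cinner x (e j)))\<^sup>2 * (norm (g j))\<^sup>2 \<le> C\<^sup>2 * (cmod (cinner x (e j)))\<^sup>2"
      by (simp add: power_mult_distrib)
  qed
  also have "\<dots> \<le> C\<^sup>2 * (norm x)\<^sup>2"
    unfolding sum_distrib_left[symmetric] by (intro mult_left_mono Bessel assms) auto
  also have "\<dots> = (C * norm x)\<^sup>2" by (simp add: power_mult_distrib)
  finally show "norm (blinfun_apply (\<Sum>j\<in>J. rank_one (c j *\<^sub>R g j) (e j)) x) \<le> C * norm x"
    by (rule power2_le_imp_le) (simp add: assms(5))
qed

text \<open>A block of the series is a diagonal operator, so its norm is at most its first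
  coefficient; no summability of \<open>s\<close> is required. Adjoint and modulus of a compact
  operator are obtained as such limits.\<close>

lemma convergent_diagonal_op:
  fixes e g :: "nat \<Rightarrow> 'a::complex_hilbert"
  assumes fam: "ortho_family e UNIV" "ortho_family g UNIV"
    and s: "decseq s" "\<And>n. 0 \<le> s n" "s \<longlonglongrightarrow> 0"
  shows "convergent (\<lambda>n. \<Sum>j<n. rank_one (s j *\<^sub>R g j) (e j))"
proof -
  let ?X = "\<lambda>n. \<Sum>j<n. rank_one (s j *\<^sub>R g j) (e j)"
  have "Cauchy ?X"
  proof (rule CauchyI')
    fix r :: real assume "r > 0"
    with s(3) have "eventually (\<lambda>n. s n < r) sequentially" by (rule order_tendstoD)
    then obtain M where M: "s M < r" by (auto simp: eventually_sequentially)
    have "dist (?X m) (?X n) < r" if "m \<ge> M" "n > m" for m n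
    proof -
      have "?X n - ?X m = (\<Sum>j\<in>{..<n} - {..<m}. rank_one (s j *\<^sub>R g j) (e j))"
        using that by (subst sum_diff) auto
      also have "norm \<dots> \<le> s M"
      proof (rule norm_diagonal_op)
        show "\<bar>s j\<bar> \<le> s M" if "j \<in> {..<n} - {..<m}" for j
          using that \<open>m \<ge> M\<close> decseqD[OF s(1), of M j] s(2)[of j] by simp
      qed (use fam s in \<open>auto intro: ortho_family_subset\<close>)
      finally show ?thesis using M by (simp add: dist_norm norm_minus_commute)
    qed
    then show "\<exists>M. \<forall>m\<ge>M. \<forall>n>m. dist (?X m) (?X n) < r" by blast
  qed
  then show ?thesis by (simp add: Cauchy_convergent_iff)
qed

text \<open>Limits are taken in the type of real-linear maps, so complex linearity has to be carried
  through them.\<close>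

lemma bounded_ops_tendsto:
  fixes f :: "'i \<Rightarrow> 'a::complex_hilbert \<Rightarrow>\<^sub>L 'a"
  assumes "F \<noteq> bot" "(f \<longlongrightarrow> b) F" "\<And>i. f i \<in> bounded_ops"
  shows "b \<in> bounded_ops"
proof -
  have scale: "((\<lambda>i. c *\<^sub>C g i) \<longlongrightarrow> c *\<^sub>C y) F" if "(g \<longlongrightarrow> y) F" for c y and g :: "'i \<Rightarrow> 'a"
  proof -
    have "bounded_linear (\<lambda>x::'a. c *\<^sub>C x)"
      by (rule bounded_linear_intro[where K = "cmod c"])
        (simp_all add: scaleC_add_right scaleR_eq_scaleC scaleC_scaleC mult.commute)
    then show ?thesis using that by (rule bounded_linear.tendsto)
  qed
  have pt: "((\<lambda>i. blinfun_apply (f i) x) \<longlongrightarrow> blinfun_apply b x) F" for x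
    using assms(2) by (rule blinfun.tendsto) simp
  have "blinfun_apply b (c *\<^sub>C x) = c *\<^sub>C blinfun_apply b x" for c x
    using tendsto_unique[OF assms(1) pt[of "c *\<^sub>C x"]] scale[OF pt[of x], of c]
    by (simp add: blinfun_scaleC assms(3))
  then show ?thesis by (simp add: bounded_ops_def)
qed

text \<open>Polarisation: real values of the form at \<open>x + y\<close> settle the imaginary part,
  those at \<open>x + \<i> *\<^sub>C y\<close> the real part.\<close>

lemma positive_op_symmetric:
  assumes "positive_op r"
  shows "cinner (blinfun_apply r x) y = cinner x (blinfun_apply r y)"
proof -
  have b: "r \<in> bounded_ops" and real: "\<And>x. Im (cinner (blinfun_apply r x) x) = 0"
    using assms by (auto simp: positive_op_def complex_is_Real_iff)
  have "Im (cinner (blinfun_apply r x) y + cinner (blinfun_apply r y) x) = 0"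
    using real[of "x + y"] real[of x] real[of y] by (simp add: blinfun.add_right cinner_simps)
  moreover have "Im (cinner (blinfun_apply r x) (\<i> *\<^sub>C y) + cinner (blinfun_apply r (\<i> *\<^sub>C y)) x) = 0"
    using real[of "x + \<i> *\<^sub>C y"] real[of x] real[of "\<i> *\<^sub>C y"] by (simp add: blinfun.add_right cinner_simps)
  then have "Re (cinner (blinfun_apply r y) x) = Re (cinner (blinfun_apply r x) y)"
    by (simp add: blinfun_scaleC b cinner_simps)
  ultimately have "cinner (blinfun_apply r x) y = cnj (cinner (blinfun_apply r y) x)"
    by (simp add: complex_eq_iff)
  then show ?thesis by (simp add: cinner_commute[of x])
qed

section \<open>Approximation numbers, adjoint, modulus and its eigenvalues from a Schmidt
  system\<close>

context schmidt_system
begin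

abbreviation proj :: "nat \<Rightarrow> 'a \<Rightarrow> 'a" where "proj n \<equiv> ortho_proj e {..<n}"

lemma norm_e: "norm (e i) = (if 0 < s i then 1 else 0)"
proof -
  have "(norm (e i))\<^sup>2 = (if 0 < s i then 1 else 0)\<^sup>2" by (simp add: Re_cinner_self[symmetric] inner)
  then show ?thesis by (rule power2_eq_imp_eq) auto
qed

lemma ortho_family_e: "ortho_family e J"
  by (auto simp: ortho_family_def inner norm_e)

lemma e_eq_0: "s i = 0 \<Longrightarrow> e i = 0"
  using norm_e[of i] by simp

lemma image_orth: "i \<noteq> j \<Longrightarrow> cinner (blinfun_apply a (e i)) (blinfun_apply a (e j)) = 0"
  by (simp add: image_inner inner)

lemma norm_image: "norm (blinfun_apply a (e i)) = s i"
proof -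
  have "(norm (blinfun_apply a (e i)))\<^sup>2 = (s i)\<^sup>2"
    using nonneg[of i] by (auto simp: Re_cinner_self[symmetric] image_inner inner)
  then show ?thesis using nonneg[of i] by (simp add: power2_eq_iff_nonneg)
qed

lemma norm_image_rest: "norm (blinfun_apply a (x - proj n x)) \<le> s n * norm x"
proof -
  have "norm (blinfun_apply a (x - proj n x)) \<le> s n * norm (x - proj n x)"
    by (rule bound) (simp add: cinner_ortho_proj_rest ortho_family_e)
  also have "\<dots> \<le> s n * norm x"
    by (intro mult_left_mono norm_ortho_proj_rest ortho_family_e nonneg) auto
  finally show ?thesis .
qed

lemma norm_truncation: "norm (a - (\<Sum>j<n. rank_one (blinfun_apply a (e j)) (e j))) \<le> s n"
proof (rule norm_blinfun_bound[OF nonneg])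
  fix x
  have "blinfun_apply (\<Sum>j<n. rank_one (blinfun_apply a (e j)) (e j)) x = blinfun_apply a (proj n x)"
    by (simp add: blinfun.sum_left ortho_proj_def blinfun_sum_scaleC bounded)
  then show "norm (blinfun_apply (a - (\<Sum>j<n. rank_one (blinfun_apply a (e j)) (e j))) x) \<le> s n * norm x"
    using norm_image_rest[of x n] by (simp add: blinfun.diff_left blinfun.diff_right)
qed

text \<open>Truncating the Schmidt series after \<open>n\<close> terms leaves norm at most
  \<open>s n\<close>. Conversely, \<open>a\<close> expands every vector in the span of
  \<open>e 0\<close> to \<open>e n\<close> by a factor of at least \<open>s n\<close>, and an
  operator of rank at most \<open>n\<close> annihilates a nonzero vector of this span.\<close>

lemma approx_number_eq: "approx_number a n = s n"
proof (rule antisym)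
  let ?f = "\<Sum>j<n. rank_one (blinfun_apply a (e j)) (e j)"
  let ?B = "(\<lambda>j. blinfun_apply a (e j)) ` {..<n}"
  have "range (blinfun_apply ?f) \<subseteq> cspan ?B"
    unfolding image_subset_iff blinfun.sum_left rank_one.rep_eq
    by (intro ballI complex_vector.span_sum complex_vector.span_scale) (auto intro: complex_vector.span_base)
  then have "approx_number a n \<le> norm (a - ?f)"
    using card_image_le[of "{..<n}"] by (intro approx_number_le[of _ ?B]) (auto intro: bounded_ops_sum)
  then show "approx_number a n \<le> s n" using norm_truncation[of n] by simp
next
  show "s n \<le> approx_number a n"
  proof (cases "s n = 0")
    case True
    then show ?thesis by (simp add: approx_number_nonneg)
  next
    case False
    have le: "s n \<le> s j" if "j \<le> n" for j using decseqD[OF decseq that] .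
    have pos: "s j > 0" if "j \<le> n" for j using le[OF that] nonneg[of n] False by linarith
    have ne: "e j \<noteq> 0" if "j \<le> n" for j using norm_e[of j] pos[OF that] by auto
    show ?thesis
    proof (rule approx_number_ge[where J = "{..n}" and I = "{}::nat set" and x = e])
      fix c v assume c: "\<exists>j\<in>{..n}. c j \<noteq> 0" and v: "v = (\<Sum>j\<in>{..n}. c j *\<^sub>C e j)"
      have "v \<noteq> 0" unfolding v
        by (rule ortho_combination_nonzero[OF _ _ _ c]) (auto simp: inner ne)
      moreover have "(norm v)\<^sup>2 = (\<Sum>j\<in>{..n}. (cmod (c j))\<^sup>2)"
        unfolding v using norm_sum_square_orthogonal[of "{..n}" e c] by (simp add: inner norm_e pos)
      moreover have "(norm (blinfun_apply a v))\<^sup>2 = (\<Sum>j\<in>{..n}. (cmod (c j))\<^sup>2 * (s j)\<^sup>2)"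
        unfolding v blinfun_sum_scaleC[OF bounded]
        using norm_sum_square_orthogonal[of "{..n}" "\<lambda>j. blinfun_apply a (e j)" c] by (simp add: image_orth norm_image)
      moreover have "(s n)\<^sup>2 * (\<Sum>j\<in>{..n}. (cmod (c j))\<^sup>2) \<le> (\<Sum>j\<in>{..n}. (cmod (c j))\<^sup>2 * (s j)\<^sup>2)"
        unfolding sum_distrib_left
        by (intro sum_mono) (simp add: mult.commute mult_right_mono power_mono le nonneg)
      ultimately show "v \<noteq> 0 \<and> s n * norm v \<le> norm (blinfun_apply a v)"
        using power2_le_imp_le[of "s n * norm v" "norm (blinfun_apply a v)"]
        by (simp add: power_mult_distrib)
    qed auto
  qed
qed

lemma proj_image_tendsto: "(\<lambda>n. blinfun_apply a (proj n x)) \<longlonglongrightarrow> blinfun_apply a x"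
proof (rule LIMSEQ_I)
  fix r :: real assume r: "r > 0"
  have "(\<lambda>n. s n * norm x) \<longlonglongrightarrow> 0" using tendsto_mult_right[OF lim, of "norm x"] by simp
  then have "eventually (\<lambda>n. s n * norm x < r) sequentially" using r by (rule order_tendstoD)
  then have "eventually (\<lambda>n. norm (blinfun_apply a (proj n x) - blinfun_apply a x) < r) sequentially"
  proof (rule eventually_mono)
    show "norm (blinfun_apply a (proj n x) - blinfun_apply a x) < r" if "s n * norm x < r" for n
      using norm_image_rest[of x n] that by (simp add: blinfun.diff_right norm_minus_commute)
  qed
  then show "\<exists>no. \<forall>n\<ge>no. norm (blinfun_apply a (proj n x) - blinfun_apply a x) < r"
    by (simp add: eventually_sequentially)
qed

text \<open>Division by zero makes \<open>g j\<close> vanish when \<open>s j = 0\<close>, matching \<open>e j = 0\<close>.\<close>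

definition g :: "nat \<Rightarrow> 'a" where "g j = (1 / s j) *\<^sub>R blinfun_apply a (e j)"

lemma scaleR_g: "s j *\<^sub>R g j = blinfun_apply a (e j)"
  using norm_image[of j] by (cases "s j = 0") (auto simp: g_def)

lemma ortho_family_g: "ortho_family g J"
  using nonneg by (auto simp: ortho_family_def g_def cinner_simps image_orth norm_image)

text \<open>The \<open>n\<close>-th partial sum is the adjoint of \<open>a\<close> preceded by the
  projection \<open>proj n\<close>, and these compositions converge to \<open>a\<close>
  pointwise.\<close>

lemma adjoint_exists:
  obtains b where "(\<lambda>n. \<Sum>j<n. rank_one (e j) (blinfun_apply a (e j))) \<longlonglongrightarrow> b"
    and "\<And>x y. cinner (blinfun_apply a x) y = cinner x (blinfun_apply b y)"
proof -
  have "rank_one (e j) (blinfun_apply a (e j)) = rank_one (s j *\<^sub>R e j) (g j)" for j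
    by (rule blinfun_eqI) (simp add: scaleR_g[symmetric] cinner_simps scaleR_eq_scaleC scaleC_scaleC mult.commute)
  then obtain b where b: "(\<lambda>n. \<Sum>j<n. rank_one (e j) (blinfun_apply a (e j))) \<longlonglongrightarrow> b"
    using convergent_diagonal_op[OF ortho_family_g ortho_family_e decseq nonneg lim] by (auto simp: convergent_def)
  have "cinner (blinfun_apply a x) y = cinner x (blinfun_apply b y)" for x y
  proof -
    have "(\<lambda>n. cinner x (blinfun_apply (\<Sum>j<n. rank_one (e j) (blinfun_apply a (e j))) y)) \<longlonglongrightarrow> cinner x (blinfun_apply b y)"
      by (intro tendsto_cinner tendsto_const blinfun.tendsto b)
    moreover have "cinner x (blinfun_apply (\<Sum>j<n. rank_one (e j) (blinfun_apply a (e j))) y) = cinner (blinfun_apply a (proj n x)) y" for n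
      by (simp add: blinfun.sum_left cinner_sum_right ortho_proj_def blinfun_sum_scaleC bounded cinner_sum_left
          cinner_scaleC_left cinner_scaleC_right cinner_commute[of y] mult.commute)
    moreover have "(\<lambda>n. cinner (blinfun_apply a (proj n x)) y) \<longlonglongrightarrow> cinner (blinfun_apply a x) y"
      by (intro tendsto_cinner tendsto_const proj_image_tendsto)
    ultimately show ?thesis using LIMSEQ_unique by fastforce
  qed
  with b that show ?thesis by blast
qed

lemma
  shows adjoint_op_tendsto: "(\<lambda>n. \<Sum>j<n. rank_one (e j) (blinfun_apply a (e j))) \<longlonglongrightarrow> adjoint_op a"
    and cinner_adjoint_op: "cinner (blinfun_apply a x) y = cinner x (blinfun_apply (adjoint_op a) y)"
proof -
  obtain b where b: "(\<lambda>n. \<Sum>j<n. rank_one (e j) (blinfun_apply a (e j))) \<longlonglongrightarrow> b"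
    "\<And>x y. cinner (blinfun_apply a x) y = cinner x (blinfun_apply b y)" using adjoint_exists by blast
  have "adjoint_op a = b"
    unfolding adjoint_op_def
  proof (rule the_equality)
    fix c assume c: "\<forall>x y. cinner (blinfun_apply a x) y = cinner x (blinfun_apply c y)"
    show "c = b"
    proof (rule blinfun_eqI)
      fix y
      have "cinner (blinfun_apply c y - blinfun_apply b y) (blinfun_apply c y - blinfun_apply b y) = 0"
        using b(2) c by (simp add: cinner_diff_right)
      then show "blinfun_apply c y = blinfun_apply b y" by simp
    qed
  qed (use b in blast)
  with b show "(\<lambda>n. \<Sum>j<n. rank_one (e j) (blinfun_apply a (e j))) \<longlonglongrightarrow> adjoint_op a"
    "cinner (blinfun_apply a x) y = cinner x (blinfun_apply (adjoint_op a) y)" by auto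
qed

text \<open>The root is the diagonal operator with eigenvectors \<open>e j\<close> and eigenvalues
  \<open>s j\<close>.\<close>

lemma sqrt_exists: "\<exists>r. positive_op r \<and> r o\<^sub>L r = adjoint_op a o\<^sub>L a"
proof -
  let ?X = "\<lambda>n. \<Sum>j<n. rank_one (s j *\<^sub>R e j) (e j)"
  obtain r where r: "?X \<longlonglongrightarrow> r"
    using convergent_diagonal_op[OF ortho_family_e ortho_family_e decseq nonneg lim] by (auto simp: convergent_def)
  have X: "blinfun_apply (?X n) x = (\<Sum>j<n. (complex_of_real (s j) * cinner x (e j)) *\<^sub>C e j)" for n x
    by (simp add: blinfun.sum_left scaleR_eq_scaleC scaleC_scaleC mult.commute)
  have "cinner (blinfun_apply r x) x \<in> \<real> \<and> 0 \<le> Re (cinner (blinfun_apply r x) x)" for x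
  proof -
    have "(\<lambda>n. cinner (blinfun_apply (?X n) x) x) \<longlonglongrightarrow> cinner (blinfun_apply r x) x"
      by (intro tendsto_cinner tendsto_const blinfun.tendsto r)
    moreover have "cinner (blinfun_apply (?X n) x) x = complex_of_real (\<Sum>j<n. s j * (cmod (cinner x (e j)))\<^sup>2)" for n
      unfolding X cinner_sum_left of_real_sum
      by (intro sum.cong) (simp_all add: cinner_scaleC_left cinner_commute[of "e _" x] complex_norm_square mult.assoc del: of_real_power)
    ultimately have *: "(\<lambda>n. complex_of_real (\<Sum>j<n. s j * (cmod (cinner x (e j)))\<^sup>2)) \<longlonglongrightarrow> cinner (blinfun_apply r x) x" by simp
    have "cinner (blinfun_apply r x) x \<in> \<real>\<^sub>\<ge>\<^sub>0"
      by (rule closed_sequentially[OF closed_nonneg_Reals_complex _ *])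
        (simp add: nonneg_Reals_of_real_iff sum_nonneg nonneg del: of_real_sum)
    then show ?thesis by (auto simp: complex_nonneg_Reals_iff complex_is_Real_iff)
  qed
  moreover have "r \<in> bounded_ops"
    by (rule bounded_ops_tendsto[OF _ r]) (auto intro: bounded_ops_sum)
  \<comment> \<open>The identity holds already at each finite stage, since both sides are diagonal
    with entries \<open>(s j)\<^sup>2\<close> for \<open>j < n\<close>; it then passes to the
    limit.\<close>
  moreover have "?X n o\<^sub>L ?X n = (\<Sum>j<n. rank_one (e j) (blinfun_apply a (e j))) o\<^sub>L a" for n
  proof (rule blinfun_eqI)
    fix x
    have 1: "cinner (blinfun_apply (?X n) x) (e j) = complex_of_real (s j) * cinner x (e j)" if "j < n" for j
    proof -
      have "cinner (blinfun_apply (?X n) x) (e j) = (\<Sum>i<n. if i = j then complex_of_real (s j) * cinner x (e j) else 0)"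
        unfolding X cinner_sum_left cinner_scaleC_left
        using e_eq_0[of j] nonneg[of j] by (intro sum.cong) (auto simp: inner)
      with that show ?thesis by simp
    qed
    have 2: "cinner (blinfun_apply a x) (blinfun_apply a (e j)) = complex_of_real ((s j)\<^sup>2) * cinner x (e j)" for j
      by (subst cinner_commute) (simp add: image_inner cinner_commute[of "e j" x])
    have "blinfun_apply (?X n) (blinfun_apply (?X n) x) = (\<Sum>j<n. (complex_of_real ((s j)\<^sup>2) * cinner x (e j)) *\<^sub>C e j)"
      by (subst X) (intro sum.cong, simp_all add: 1 power2_eq_square)
    then show "blinfun_apply (?X n o\<^sub>L ?X n) x = blinfun_apply ((\<Sum>j<n. rank_one (e j) (blinfun_apply a (e j))) o\<^sub>L a) x"
      by (simp only: blinfun_apply_blinfun_compose) (simp add: blinfun.sum_left 2)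
  qed
  with bounded_bilinear.tendsto[OF bounded_bilinear_blinfun_compose r r]
  have "(\<lambda>n. (\<Sum>j<n. rank_one (e j) (blinfun_apply a (e j))) o\<^sub>L a) \<longlonglongrightarrow> (r o\<^sub>L r)" by simp
  then have "r o\<^sub>L r = adjoint_op a o\<^sub>L a"
    using bounded_bilinear.tendsto[OF bounded_bilinear_blinfun_compose adjoint_op_tendsto tendsto_const]
    by (rule LIMSEQ_unique)
  ultimately show ?thesis unfolding positive_op_def by blast
qed

text \<open>These two properties determine any positive root \<open>r\<close>. For the second,
  \<open>y = r (e j) - s j *\<^sub>R e j\<close> satisfies \<open>r y = - (s j *\<^sub>R y)\<close>,
  which positivity of \<open>r\<close> excludes unless \<open>y = 0\<close>.\<close>

lemma
  assumes r: "positive_op r" "r o\<^sub>L r = adjoint_op a o\<^sub>L a"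
  shows norm_sqrt: "norm (blinfun_apply r x) = norm (blinfun_apply a x)"
    and sqrt_e: "blinfun_apply r (e j) = s j *\<^sub>R e j"
proof -
  have sq: "blinfun_apply r (blinfun_apply r x) = blinfun_apply (adjoint_op a) (blinfun_apply a x)" for x
    using r(2) by (metis blinfun_apply_blinfun_compose)
  have "cinner (blinfun_apply r x) (blinfun_apply r x) = cinner (blinfun_apply a x) (blinfun_apply a x)"
    unfolding positive_op_symmetric[OF r(1), of x] sq cinner_adjoint_op[symmetric] ..
  then have "(norm (blinfun_apply r x))\<^sup>2 = (norm (blinfun_apply a x))\<^sup>2"
    unfolding Re_cinner_self[symmetric] by simp
  then show "norm (blinfun_apply r x) = norm (blinfun_apply a x)" by (simp add: power2_eq_iff_nonneg)
  have eig: "blinfun_apply r (blinfun_apply r (e j)) = (s j)\<^sup>2 *\<^sub>R e j"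
  proof -
    define y where "y = blinfun_apply r (blinfun_apply r (e j)) - (s j)\<^sup>2 *\<^sub>R e j"
    have "cinner (blinfun_apply r (blinfun_apply r (e j))) y = complex_of_real ((s j)\<^sup>2) * cinner (e j) y"
      unfolding sq image_inner[symmetric] by (metis cinner_adjoint_op cinner_commute)
    then have "cinner y y = 0" by (subst y_def) (simp add: cinner_simps)
    then show ?thesis by (simp add: y_def)
  qed
  show "blinfun_apply r (e j) = s j *\<^sub>R e j"
  proof (cases "s j = 0")
    case False
    define y where "y = blinfun_apply r (e j) - s j *\<^sub>R e j"
    have "blinfun_apply r y = - (s j *\<^sub>R y)"
      by (simp add: y_def blinfun.diff_right blinfun.scaleR_right eig algebra_simps power2_eq_square)
    then have "Re (cinner (blinfun_apply r y) y) = - s j * (norm y)\<^sup>2"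
      by (simp add: cinner_simps cinner_self)
    moreover have "0 \<le> Re (cinner (blinfun_apply r y) y)" using r(1) by (simp add: positive_op_def)
    ultimately have "y = 0" using False nonneg[of j] by (auto simp: mult_le_0_iff)
    then show ?thesis by (simp add: y_def)
  qed (simp add: e_eq_0)
qed

text \<open>Two roots agree on the span of the \<open>e j\<close>, and on what is left after
  \<open>proj n\<close> both are bounded by \<open>s n\<close>, which tends to 0. Hence the definite
  description in \<open>sqrt_op\<close> denotes.\<close>

lemma sqrt_unique:
  assumes "positive_op r" "r o\<^sub>L r = adjoint_op a o\<^sub>L a" "positive_op r'" "r' o\<^sub>L r' = adjoint_op a o\<^sub>L a"
  shows "r = r'"
proof (rule blinfun_eqI)
  fix x
  have b: "r \<in> bounded_ops" "r' \<in> bounded_ops" using assms by (auto simp: positive_op_def)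
  have "norm (blinfun_apply r x - blinfun_apply r' x) \<le> 2 * (s n * norm x)" for n
  proof -
    have "blinfun_apply r (proj n x) = blinfun_apply r' (proj n x)"
      unfolding ortho_proj_def blinfun_sum_scaleC[OF b(1)] blinfun_sum_scaleC[OF b(2)]
      using sqrt_e assms by simp
    then have "blinfun_apply r x - blinfun_apply r' x = blinfun_apply r (x - proj n x) - blinfun_apply r' (x - proj n x)"
      by (simp add: blinfun.diff_right)
    also have "norm \<dots> \<le> norm (blinfun_apply r (x - proj n x)) + norm (blinfun_apply r' (x - proj n x))"
      by (rule norm_triangle_ineq4)
    also have "\<dots> \<le> 2 * (s n * norm x)"
      using norm_image_rest[of x n] norm_sqrt[OF assms(1,2)] norm_sqrt[OF assms(3,4)] by simp
    finally show ?thesis .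
  qed
  moreover have "(\<lambda>n. 2 * (s n * norm x)) \<longlonglongrightarrow> 0"
    using tendsto_mult[OF tendsto_const tendsto_mult_right[OF lim, of "norm x"], of 2] by simp
  ultimately have "norm (blinfun_apply r x - blinfun_apply r' x) \<le> 0"
    using LIMSEQ_le_const[of "\<lambda>n. 2 * (s n * norm x)" 0] by blast
  then show "blinfun_apply r x = blinfun_apply r' x" by simp
qed

lemma abs_op: "positive_op (abs_op a)" "abs_op a o\<^sub>L abs_op a = adjoint_op a o\<^sub>L a"
proof -
  have "positive_op (abs_op a) \<and> abs_op a o\<^sub>L abs_op a = adjoint_op a o\<^sub>L a"
    unfolding abs_op_def sqrt_op_def
    by (rule theI') (use sqrt_exists sqrt_unique in blast)
  then show "positive_op (abs_op a)" "abs_op a o\<^sub>L abs_op a = adjoint_op a o\<^sub>L a" by auto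
qed

lemma finite_level: "l > 0 \<Longrightarrow> finite {n. l \<le> s n}"
proof -
  assume "l > 0"
  with lim have "eventually (\<lambda>n. s n < l) sequentially" by (rule order_tendstoD)
  then obtain N where "\<And>n. n \<ge> N \<Longrightarrow> s n < l" by (auto simp: eventually_sequentially)
  then have "{n. l \<le> s n} \<subseteq> {..<N}" by (metis (mono_tags) mem_Collect_eq subsetI lessThan_iff not_le)
  then show ?thesis by (rule finite_subset) simp
qed

text \<open>The eigenspace for \<open>l\<close> is spanned by the orthonormal vectors
  \<open>e j\<close> with \<open>s j = l\<close>, so its dimension counts these indices.\<close>

lemma eigen_mult_abs_op:
  assumes l: "l > 0"
  shows "eigen_mult (abs_op a) l = card {n. s n = l}"
proof -
  let ?r = "abs_op a" and ?J = "{n. s n = l}"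
  let ?E = "{x. blinfun_apply ?r x = complex_of_real l *\<^sub>C x}"
  have fin: "finite ?J" using finite_level[OF l] by (rule rev_finite_subset) auto
  have rb: "?r \<in> bounded_ops" using abs_op by (simp add: positive_op_def)
  have re: "blinfun_apply ?r (e j) = complex_of_real (s j) *\<^sub>C e j" for j
    using sqrt_e[OF abs_op] by (simp add: scaleR_eq_scaleC)
  have inj: "inj_on e ?J"
  proof (rule inj_onI)
    fix i j assume "i \<in> ?J" "j \<in> ?J" "e i = e j"
    then show "i = j" using inner[of i i] inner[of i j] l by (auto split: if_splits)
  qed
  have indep: "complex_vector.independent (e ` ?J)"
  proof (rule complex_vector.independent_if_scalars_zero)
    fix f x assume f: "(\<Sum>x\<in>e ` ?J. f x *\<^sub>C x) = 0" and x: "x \<in> e ` ?J"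
    have "(\<Sum>j\<in>?J. f (e j) *\<^sub>C e j) = 0" using f by (simp add: sum.reindex[OF inj])
    moreover have "e j \<noteq> 0" if "j \<in> ?J" for j using norm_e[of j] that l by auto
    ultimately have "\<not> (\<exists>j\<in>?J. f (e j) \<noteq> 0)"
      using ortho_combination_nonzero[of ?J e "\<lambda>j. f (e j)"] fin by (auto simp: inner)
    then show "f x = 0" using x by blast
  qed (simp add: fin)
  have "cspan (e ` ?J) = ?E"
  proof
    have "complex_vector.subspace ?E"
      by (rule complex_vector.subspaceI)
        (auto simp: blinfun.add_right scaleC_add_right blinfun_scaleC rb scaleC_scaleC mult.commute)
    moreover have "e ` ?J \<subseteq> ?E" using re by auto
    ultimately show "cspan (e ` ?J) \<subseteq> ?E" by (intro complex_vector.span_minimal)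
    show "?E \<subseteq> cspan (e ` ?J)"
    proof
      fix x assume x: "x \<in> ?E"
      define p where "p = ortho_proj e ?J x"
      have p: "p \<in> cspan (e ` ?J)"
        unfolding p_def ortho_proj_def
        by (intro complex_vector.span_sum complex_vector.span_scale) (auto intro: complex_vector.span_base)
      have "p \<in> ?E" using \<open>cspan (e ` ?J) \<subseteq> ?E\<close> p by blast
      then have z: "blinfun_apply ?r (x - p) = complex_of_real l *\<^sub>C (x - p)"
        using x by (simp add: blinfun.diff_right complex_vector.scale_right_diff_distrib)
      \<comment> \<open>For \<open>s j = l\<close> the projection removes \<open>e j\<close>; for
        \<open>s j \<noteq> l\<close> eigenvectors of a symmetric operator are orthogonal. Being
        orthogonal to every \<open>e j\<close>, the eigenvector \<open>x - p\<close> obeys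
        \<open>bound\<close> for all \<open>n\<close> and must vanish.\<close>
      have orth: "cinner (x - p) (e j) = 0" for j
      proof (cases "s j = l")
        case True
        then show ?thesis using fin unfolding p_def by (intro cinner_ortho_proj_rest ortho_family_e) auto
      next
        case False
        have "cinner (blinfun_apply ?r (x - p)) (e j) = cinner (x - p) (blinfun_apply ?r (e j))"
          by (rule positive_op_symmetric[OF abs_op(1)])
        then show ?thesis using False unfolding z re by (auto simp: cinner_scaleC_left cinner_scaleC_right)
      qed
      have "l * norm (x - p) \<le> s n * norm (x - p)" for n
      proof -
        have "norm (blinfun_apply ?r (x - p)) \<le> s n * norm (x - p)"
          unfolding norm_sqrt[OF abs_op] by (rule bound) (rule orth)
        then show ?thesis unfolding z using l by simp
      qed
      moreover have "(\<lambda>n. s n * norm (x - p)) \<longlonglongrightarrow> 0" using tendsto_mult_right[OF lim] by simp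
      ultimately have "l * norm (x - p) \<le> 0" by (intro LIMSEQ_le_const) auto
      then have "x = p" using l by (simp add: mult_le_0_iff)
      with p show "x \<in> cspan (e ` ?J)" by simp
    qed
  qed
  then have "eigen_mult ?r l = cdim (cspan (e ` ?J))" by (simp add: eigen_mult_def)
  also have "\<dots> = card (e ` ?J)" using complex_vector.dim_span_eq_card_independent[OF indep] .
  also have "\<dots> = card ?J" using inj by (rule card_image)
  finally show ?thesis .
qed

lemma is_singular_value_seq: "is_singular_value_seq a s"
  unfolding is_singular_value_seq_def
proof (intro conjI allI impI)
  fix l :: real assume l: "l > 0"
  show "finite {n. s n = l}" using finite_level[OF l] by (rule rev_finite_subset) auto
qed (simp_all add: decseq nonneg eigen_mult_abs_op)

text \<open>The multiplicities determine how many entries are at least \<open>l\<close>. In a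
  decreasing sequence these entries form an initial segment, so both sequences have the same
  superlevel sets for every \<open>l > 0\<close>.\<close>

lemma singular_value_seq_unique:
  assumes "is_singular_value_seq a t"
  shows "t = s"
proof -
  have t: "decseq t" "\<And>n. 0 \<le> t n" "\<And>l. l > 0 \<Longrightarrow> finite {n. t n = l}"
    "\<And>l. l > 0 \<Longrightarrow> card {n. t n = l} = card {n. s n = l}"
    using assms eigen_mult_abs_op by (auto simp: is_singular_value_seq_def)
  have fs: "finite {n. s n = l}" if "l > 0" for l
    using finite_level[OF that] by (rule rev_finite_subset) auto
  have level: "card {n. l \<le> t n} = card {n. l \<le> s n} \<and> finite {n. l \<le> t n}" if l: "l > 0" for l
  proof -
    define V where "V = s ` {n. l \<le> s n}"
    have V: "finite V" "\<And>v. v \<in> V \<Longrightarrow> v > 0" "\<And>v. v \<in> V \<Longrightarrow> l \<le> v"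
      using finite_level[OF l] l by (auto simp: V_def)
    \<comment> \<open>A value of \<open>t\<close> has positive multiplicity and therefore occurs in
      \<open>s\<close>; so the finite set \<open>V\<close> also holds all values of \<open>t\<close>
      from \<open>l\<close> upwards.\<close>
    have "t n \<in> V" if "l \<le> t n" for n
    proof -
      have "card {m. t m = t n} \<noteq> 0" using t(3)[of "t n"] that l by auto
      then have "card {m. s m = t n} \<noteq> 0" using t(4)[of "t n"] that l by simp
      then obtain m where "s m = t n" by (metis (mono_tags, lifting) Collect_empty_eq card.empty)
      with that show ?thesis by (auto simp: V_def image_iff intro!: exI[of _ m])
    qed
    then have Ut: "{n. l \<le> t n} = (\<Union>v\<in>V. {n. t n = v})" using V by auto
    have "s n \<in> V" if "l \<le> s n" for n using that by (simp add: V_def)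
    then have Us: "{n. l \<le> s n} = (\<Union>v\<in>V. {n. s n = v})" using V by auto
    have "card (\<Union>v\<in>V. {n. t n = v}) = (\<Sum>v\<in>V. card {n. t n = v})"
      using V t(3) by (intro card_UN_disjoint) auto
    also have "\<dots> = (\<Sum>v\<in>V. card {n. s n = v})" using V t(4) by (intro sum.cong) auto
    also have "\<dots> = card (\<Union>v\<in>V. {n. s n = v})"
      using V fs by (intro card_UN_disjoint[symmetric]) auto
    finally show ?thesis using V t(3) unfolding Ut Us by auto
  qed
  have initial: "{n. l \<le> u n} = {..<card {n. l \<le> u n}}"
    if "decseq u" "finite {n. l \<le> u n}" for u :: "nat \<Rightarrow> real" and l
  proof -
    have "\<exists>k. {n. l \<le> u n} = {..<k}"
    proof -
      have "\<exists>n. \<not> l \<le> u n" using that(2) by (metis (mono_tags) UNIV_I ex_new_if_finite infinite_UNIV_nat mem_Collect_eq)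
      define k where "k = (LEAST n. \<not> l \<le> u n)"
      have "\<not> l \<le> u k" unfolding k_def using \<open>\<exists>n. \<not> l \<le> u n\<close> by (rule LeastI_ex)
      then have "n < k" if "l \<le> u n" for n
        using that decseqD[OF \<open>decseq u\<close>, of k n] by (metis not_le order_trans)
      moreover have "l \<le> u n" if "n < k" for n
        using not_less_Least[of n "\<lambda>n. \<not> l \<le> u n"] that by (auto simp: k_def)
      ultimately show ?thesis by (intro exI[of _ k]) auto
    qed
    then show ?thesis by (metis card_lessThan)
  qed
  have "{n. l \<le> t n} = {n. l \<le> s n}" if "l > 0" for l
    using initial[OF t(1)] initial[OF decseq] level[OF that] finite_level[OF that] by metis
  then have *: "l \<le> t n \<longleftrightarrow> l \<le> s n" if "l > 0" for l n using that by blast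
  show ?thesis
  proof
    fix n
    show "t n = s n"
    proof (rule antisym)
      show "t n \<le> s n" using *[of "t n" n] t(2)[of n] nonneg[of n] by (cases "t n = 0") auto
      show "s n \<le> t n" using *[of "s n" n] t(2)[of n] nonneg[of n] by (cases "s n = 0") auto
    qed
  qed
qed

end

text \<open>Unites the two branches of \<open>singular_value\<close>, so that all estimates can be
  made for approximation numbers.\<close>

lemma singular_value_eq_approx_number: "singular_value a = approx_number a"
proof (cases "a \<in> compact_ops")
  case True
  then obtain e s where "schmidt_system a e s" using schmidt_system_exists by blast
  then interpret schmidt_system a e s .
  have "(THE s. is_singular_value_seq a s) = s"
    using is_singular_value_seq singular_value_seq_unique by (rule the_equality)
  also have "s = approx_number a" using approx_number_eq by auto
  finally show ?thesis using True by (simp add: singular_value_def)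
qed (simp add: singular_value_def)

section \<open>Dilations and finite-rank perturbations\<close>

text \<open>Trace norm at most \<open>t\<close>, in its dual form: pairing with two orthonormal
  families makes subadditivity immediate and avoids defining a trace.\<close>

definition nuclear_le :: "('a::complex_hilbert \<Rightarrow>\<^sub>L 'a) \<Rightarrow> real \<Rightarrow> bool" where
  "nuclear_le T t \<longleftrightarrow> (\<forall>e g N. ortho_family e {..<N::nat} \<longrightarrow> ortho_family g {..<N} \<longrightarrow>
     (\<Sum>i<N. cmod (cinner (blinfun_apply T (e i)) (g i))) \<le> t)"

lemma nuclear_le_zero: "nuclear_le 0 0"
  by (simp add: nuclear_le_def)

lemma nuclear_le_add:
  assumes "nuclear_le S s" "nuclear_le T t"
  shows "nuclear_le (S + T) (s + t)"
  unfolding nuclear_le_def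
proof (intro allI impI)
  fix e g :: "nat \<Rightarrow> 'a" and N
  assume eg: "ortho_family e {..<N}" "ortho_family g {..<N}"
  have "(\<Sum>i<N. cmod (cinner (blinfun_apply (S + T) (e i)) (g i)))
      \<le> (\<Sum>i<N. cmod (cinner (blinfun_apply S (e i)) (g i)) + cmod (cinner (blinfun_apply T (e i)) (g i)))"
    by (intro sum_mono) (simp add: blinfun.add_left cinner_add_left norm_triangle_ineq)
  also have "\<dots> \<le> s + t"
    unfolding sum.distrib using assms eg by (intro add_mono) (auto simp: nuclear_le_def)
  finally show "(\<Sum>i<N. cmod (cinner (blinfun_apply (S + T) (e i)) (g i))) \<le> s + t" .
qed

lemma nuclear_le_sum:
  "(\<And>j. j \<in> J \<Longrightarrow> nuclear_le (T j) (t j)) \<Longrightarrow> nuclear_le (sum T J) (sum t J)"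
  by (induction J rule: infinite_finite_induct) (auto intro: nuclear_le_zero nuclear_le_add)

lemma nuclear_le_rank_one: "nuclear_le (rank_one w w) ((norm w)\<^sup>2)"
  unfolding nuclear_le_def
proof (intro allI impI)
  fix e g :: "nat \<Rightarrow> 'a" and N
  assume eg: "ortho_family e {..<N}" "ortho_family g {..<N}"
  have "cmod (cinner (blinfun_apply (rank_one w w) (e i)) (g i))
      \<le> ((cmod (cinner w (e i)))\<^sup>2 + (cmod (cinner w (g i)))\<^sup>2) / 2" for i
    using sum_squares_bound[of "cmod (cinner w (e i))" "cmod (cinner w (g i))"]
    by (simp add: cinner_scaleC_left norm_mult cinner_commute[of "e i" w])
  then have "(\<Sum>i<N. cmod (cinner (blinfun_apply (rank_one w w) (e i)) (g i)))
      \<le> (\<Sum>i<N. ((cmod (cinner w (e i)))\<^sup>2 + (cmod (cinner w (g i)))\<^sup>2) / 2)"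
    by (rule sum_mono)
  also have "\<dots> = ((\<Sum>i<N. (cmod (cinner w (e i)))\<^sup>2) + (\<Sum>i<N. (cmod (cinner w (g i)))\<^sup>2)) / 2"
    by (simp add: sum_divide_distrib[symmetric] sum.distrib)
  also have "\<dots> \<le> (norm w)\<^sup>2"
    using Bessel[OF eg(1), of w] Bessel[OF eg(2), of w] by simp
  finally show "(\<Sum>i<N. cmod (cinner (blinfun_apply (rank_one w w) (e i)) (g i))) \<le> (norm w)\<^sup>2" .
qed

text \<open>Left and right Schmidt vectors are the extremal test families: on them each pairing
  equals a singular value.\<close>

lemma sum_approx_number_le_nuclear:
  assumes "T \<in> compact_ops" "nuclear_le T t"
  shows "(\<Sum>i<N. approx_number T i) \<le> t"
proof -
  obtain e s where "schmidt_system T e s" using schmidt_system_exists assms(1) by blast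
  then interpret schmidt_system T e s .
  have "approx_number T i = cmod (cinner (blinfun_apply T (e i)) (g i))" for i
  proof -
    have "cinner (blinfun_apply T (e i)) (g i) = complex_of_real (s i) * cinner (g i) (g i)"
      by (simp add: scaleR_g[symmetric] cinner_scaleR_left)
    moreover have "norm (g i) = 1" if "s i \<noteq> 0" using that nonneg[of i] by (simp add: g_def norm_image)
    ultimately show ?thesis
      using nonneg[of i] by (cases "s i = 0") (auto simp: cinner_self approx_number_eq)
  qed
  then show ?thesis using assms(2) ortho_family_e ortho_family_g by (simp add: nuclear_le_def)
qed

text \<open>In contrast to \<open>ortho_family\<close>, zero vectors are excluded, so
  \<open>m\<close> is the dimension of the span.\<close>

definition orthonormal :: "(nat \<Rightarrow> 'a::complex_hilbert) \<Rightarrow> nat \<Rightarrow> bool" where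
  "orthonormal u m \<longleftrightarrow> (\<forall>i<m. \<forall>j<m. cinner (u i) (u j) = (if i = j then 1 else 0))"

lemma orthonormalD:
  "orthonormal u m \<Longrightarrow> i < m \<Longrightarrow> j < m \<Longrightarrow> cinner (u i) (u j) = (if i = j then 1 else 0)"
  by (simp add: orthonormal_def)

lemma orthonormal_norm: "orthonormal u m \<Longrightarrow> i < m \<Longrightarrow> norm (u i) = 1"
proof -
  assume "orthonormal u m" "i < m"
  then have "(norm (u i))\<^sup>2 = 1\<^sup>2" by (simp add: Re_cinner_self[symmetric] orthonormal_def)
  then show ?thesis by (rule power2_eq_imp_eq) auto
qed

lemma orthonormal_nonzero: "orthonormal u m \<Longrightarrow> i < m \<Longrightarrow> u i \<noteq> 0"
  using orthonormal_norm[of u m i] by auto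

lemma orthonormal_ortho_family: "orthonormal u m \<Longrightarrow> ortho_family u {..<m}"
  by (auto simp: ortho_family_def orthonormal_norm orthonormalD)

lemma ortho_proj_sum: "ortho_proj u J (\<Sum>i\<in>I. c i *\<^sub>C x i) = (\<Sum>i\<in>I. c i *\<^sub>C ortho_proj u J (x i))"
  unfolding ortho_proj_def
  by (simp add: cinner_sum_left complex_vector.scale_sum_left cinner_scaleC_left
      complex_vector.scale_sum_right scaleC_scaleC sum.swap[of _ I J])

lemma ortho_proj_scaleR: "ortho_proj u J (c *\<^sub>R x) = c *\<^sub>R ortho_proj u J x"
  unfolding ortho_proj_def scaleR_sum_right
  by (simp add: cinner_scaleC_left scaleR_eq_scaleC scaleC_scaleC)

lemma ortho_proj_zero: "ortho_proj u J 0 = 0"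
  by (simp add: ortho_proj_def)

lemma ortho_proj_add: "ortho_proj u J (x + y) = ortho_proj u J x + ortho_proj u J y"
  by (simp add: ortho_proj_def cinner_add_left scaleC_add_left sum.distrib)

lemma ortho_proj_member:
  assumes "orthonormal u m" "j < m"
  shows "ortho_proj u {..<m} (u j) = u j"
proof -
  have "ortho_proj u {..<m} (u j) = (\<Sum>i<m. if i = j then u j else 0)"
    unfolding ortho_proj_def
    by (intro sum.cong) (use assms in \<open>auto simp: orthonormalD scaleC_one\<close>)
  then show ?thesis using assms(2) by simp
qed

lemma ortho_proj_symmetric: "cinner (ortho_proj u J x) y = cinner x (ortho_proj u J y)"
  unfolding ortho_proj_def cinner_sum_left cinner_sum_right
  by (intro sum.cong) (simp_all add: cinner_scaleC_left cinner_scaleC_right cinner_commute[of y])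

text \<open>By Cauchy-Schwarz, a lower bound for the quadratic form becomes the norm bound that
  \<open>approx_number_ge\<close> asks for.\<close>

lemma norm_ge_of_quadratic_form:
  assumes "C * (norm v)\<^sup>2 \<le> Re (cinner (blinfun_apply T v) v)"
  shows "C * norm v \<le> norm (blinfun_apply T v)"
proof (cases "v = 0")
  case False
  have "C * norm v * norm v \<le> norm (blinfun_apply T v) * norm v"
    using assms complex_Re_le_cmod[of "cinner (blinfun_apply T v) v"] Cauchy_Schwarz_cinner[of "blinfun_apply T v" v]
    by (simp add: power2_eq_square mult.assoc)
  with False show ?thesis by simp
qed simp

lemma norm_prod_square:
  "(norm (z :: 'a::real_normed_vector \<times> 'b::real_normed_vector))\<^sup>2 = (norm (fst z))\<^sup>2 + (norm (snd z))\<^sup>2"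
  by (simp add: norm_prod_def)

lemma scaleC_combination_pair:
  fixes x :: "'i \<Rightarrow> 'a::complex_hilbert \<times> 'b::complex_hilbert"
  shows "(\<Sum>j\<in>J. c j *\<^sub>C x j) = (\<Sum>j\<in>J. c j *\<^sub>C fst (x j), \<Sum>j\<in>J. c j *\<^sub>C snd (x j))"
  by (simp add: prod_eq_iff fst_sum snd_sum scaleC_prod_def)

text \<open>Here \<open>T\<close> dominates the shifted self-adjoint dilation of \<open>a\<close> on a product of two
  \<open>m\<close>-dimensional spaces.\<close>

locale dominated_dilation = schmidt_system a e s
  for a :: "'a::complex_hilbert \<Rightarrow>\<^sub>L 'a" and e s +
  fixes T :: "('a \<times> 'a) \<Rightarrow>\<^sub>L ('a \<times> 'a)" and u v :: "nat \<Rightarrow> 'a" and m :: nat and K :: real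
  assumes u: "orthonormal u m" and v: "orthonormal v m"
    and source: "blinfun_apply a (ortho_proj u {..<m} x) = blinfun_apply a x"
    and target: "ortho_proj v {..<m} (blinfun_apply a x) = blinfun_apply a x"
    and dominates: "\<lbrakk>ortho_proj u {..<m} x = x; ortho_proj v {..<m} y = y\<rbrakk> \<Longrightarrow>
      K * ((norm x)\<^sup>2 + (norm y)\<^sup>2) + 2 * Re (cinner (blinfun_apply a x) y)
        \<le> Re (cinner (blinfun_apply T (x, y)) (x, y))"
begin

text \<open>The part of \<open>e j\<close> outside the span of \<open>u\<close> is annihilated by
  \<open>a\<close>, and by \<open>image_inner\<close> such a vector is orthogonal to
  \<open>e j\<close> when \<open>s j\<close> is nonzero.\<close>

lemma e_in: "s j \<noteq> 0 \<Longrightarrow> ortho_proj u {..<m} (e j) = e j"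
proof -
  assume s: "s j \<noteq> 0"
  define z where "z = e j - ortho_proj u {..<m} (e j)"
  have "blinfun_apply a z = 0" by (simp add: z_def blinfun.diff_right source)
  then have "complex_of_real ((s j)\<^sup>2) * cinner (e j) z = 0" using image_inner[of j z] by simp
  then have "cinner (e j) z = 0" using s by simp
  moreover have "cinner z (ortho_proj u {..<m} (e j)) = 0"
    unfolding ortho_proj_def[of _ _ "e j"] cinner_sum_right cinner_scaleC_right
    by (intro sum.neutral) (simp add: z_def cinner_ortho_proj_rest orthonormal_ortho_family[OF u])
  then have "cinner (ortho_proj u {..<m} (e j)) z = 0"
    by (subst cinner_commute) simp
  ultimately have "cinner z z = 0" unfolding z_def by (simp add: cinner_diff_left)
  then show ?thesis by (simp add: z_def)
qed

lemma g_in: "ortho_proj v {..<m} (g j) = g j"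
  by (simp add: g_def ortho_proj_scaleR target)

lemma norm_g: "s j \<noteq> 0 \<Longrightarrow> norm (g j) = 1"
  using nonneg[of j] by (simp add: g_def norm_image)

text \<open>The vectors \<open>(e j, g j)\<close> are eigenvectors of the dilation of
  \<open>a\<close> for the eigenvalues \<open>s j\<close>. On the span of those with
  \<open>j \<le> i\<close> the shifted form is at least \<open>K + s i\<close> times the squared
  norm, and these are \<open>Suc i\<close> directions against rank \<open>i\<close>.\<close>

lemma approx_number_upper_half:
  assumes i: "i < m"
  shows "K + s i \<le> approx_number T i"
\<comment> \<open>Here \<open>e i\<close> and \<open>g i\<close> vanish and cannot serve as test
  vectors. On the first factor the dilation form is zero, so the vectors \<open>(u j, 0)\<close>
  give the bound \<open>K\<close>.\<close>
proof (cases "s i = 0")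
  case True
  show ?thesis
  proof (rule approx_number_ge[where J = "{..i}" and I = "{}::nat set" and x = "\<lambda>j. (u j, 0)"])
    fix c w assume c: "\<exists>j\<in>{..i}. c j \<noteq> 0" and w: "w = (\<Sum>j\<in>{..i}. c j *\<^sub>C (u j, 0::'a))"
    have "w \<noteq> 0" unfolding w
      using i by (intro ortho_combination_nonzero[OF _ _ _ c])
        (auto simp: cinner_prod_def orthonormalD[OF u] prod_eq_iff orthonormal_nonzero[OF u])
    moreover have w': "w = (\<Sum>j\<in>{..i}. c j *\<^sub>C u j, 0)" unfolding w scaleC_combination_pair by simp
    have "ortho_proj u {..<m} (fst w) = fst w"
      using i by (simp add: w' ortho_proj_sum ortho_proj_member[OF u])
    then have "(K + s i) * (norm w)\<^sup>2 \<le> Re (cinner (blinfun_apply T w) w)"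
      using dominates[of "fst w" 0] True by (simp add: w' norm_prod_square ortho_proj_zero)
    ultimately show "w \<noteq> 0 \<and> (K + s i) * norm w \<le> norm (blinfun_apply T w)"
      using norm_ge_of_quadratic_form by blast
  qed auto
next
  case False
  have le: "s i \<le> s j" if "j \<le> i" for j using decseqD[OF decseq that] .
  have pos: "s j \<noteq> 0" if "j \<le> i" for j using le[OF that] nonneg[of i] False by linarith
  show ?thesis
  proof (rule approx_number_ge[where J = "{..i}" and I = "{}::nat set" and x = "\<lambda>j. (e j, g j)"])
    fix c w assume c: "\<exists>j\<in>{..i}. c j \<noteq> 0" and w: "w = (\<Sum>j\<in>{..i}. c j *\<^sub>C (e j, g j))"
    define X where "X = (\<Sum>j\<in>{..i}. c j *\<^sub>C e j)"
    define Y where "Y = (\<Sum>j\<in>{..i}. c j *\<^sub>C g j)"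
    have w': "w = (X, Y)" unfolding w scaleC_combination_pair X_def Y_def by simp
    have "e j \<noteq> 0" if "j \<le> i" for j using norm_e[of j] nonneg[of j] pos[OF that] by auto
    then have w0: "w \<noteq> 0" unfolding w
      using ortho_family_g[of UNIV] by (intro ortho_combination_nonzero[OF _ _ _ c])
        (auto simp: cinner_prod_def inner ortho_family_def prod_eq_iff)
    have "norm (e j) = 1" if "j \<le> i" for j using norm_e[of j] nonneg[of j] pos[OF that] by auto
    then have X: "(norm X)\<^sup>2 = (\<Sum>j\<in>{..i}. (cmod (c j))\<^sup>2)"
      using norm_sum_square_orthogonal[of "{..i}" e c] by (simp add: X_def inner)
    have Y: "(norm Y)\<^sup>2 = (\<Sum>j\<in>{..i}. (cmod (c j))\<^sup>2)"
      using norm_sum_square_orthogonal[of "{..i}" g c] ortho_family_g[of UNIV]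
      by (simp add: Y_def norm_g pos ortho_family_def)
    have "cinner (blinfun_apply a X) Y = (\<Sum>j\<in>{..i}. complex_of_real (s j * (cmod (c j))\<^sup>2))"
    proof -
      have "cinner (g j) Y = cnj (c j)" if "j \<in> {..i}" for j
      proof -
        have "cinner (g j) Y = (\<Sum>k\<in>{..i}. if k = j then cnj (c j) else 0)"
          unfolding Y_def cinner_sum_right cinner_scaleC_right
          using ortho_family_g[of UNIV] norm_g[of j] pos[of j] that
          by (intro sum.cong) (auto simp: ortho_family_def cinner_self)
        then show ?thesis using that by simp
      qed
      then show ?thesis
        unfolding X_def blinfun_sum_scaleC[OF bounded] scaleR_g[symmetric] cinner_sum_left
        by (intro sum.cong) (simp_all add: cinner_scaleC_left cinner_scaleR_left complex_norm_square mult_ac del: of_real_power)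
    qed
    then have "Re (cinner (blinfun_apply a X) Y) = (\<Sum>j\<in>{..i}. s j * (cmod (c j))\<^sup>2)" by simp
    moreover have "(\<Sum>j\<in>{..i}. s i * (cmod (c j))\<^sup>2) \<le> (\<Sum>j\<in>{..i}. s j * (cmod (c j))\<^sup>2)"
      by (intro sum_mono mult_right_mono le) auto
    ultimately have "s i * (norm X)\<^sup>2 \<le> Re (cinner (blinfun_apply a X) Y)" by (simp add: X sum_distrib_left)
    moreover have "ortho_proj u {..<m} X = X" "ortho_proj v {..<m} Y = Y"
      by (simp_all add: X_def Y_def ortho_proj_sum e_in pos g_in)
    ultimately have "(K + s i) * (norm w)\<^sup>2 \<le> Re (cinner (blinfun_apply T w) w)"
      using dominates[of X Y] X Y by (simp add: w' norm_prod_square algebra_simps)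
    with w0 show "w \<noteq> 0 \<and> (K + s i) * norm w \<le> norm (blinfun_apply T w)"
      using norm_ge_of_quadratic_form by blast
  qed auto
qed

text \<open>The vectors \<open>(e k, - g k)\<close> belong to the eigenvalues \<open>- s k\<close>
  of the dilation. Orthogonality to those with \<open>k < i\<close> leaves a form of at least
  \<open>K - s i\<close>. The count is tight: rank \<open>2 * m - Suc i\<close> and \<open>i\<close>
  constraints impose \<open>2 * m - 1\<close> conditions on \<open>2 * m\<close> directions.\<close>

lemma approx_number_lower_half:
  assumes i: "i < m"
  shows "K - s i \<le> approx_number T (2 * m - Suc i)"
proof (rule approx_number_ge[where J = "{..<2 * m}" and I = "{..<i}" and w = "\<lambda>k. (e k, - g k)"
      and x = "\<lambda>j. if j < m then (u j, 0) else (0, v (j - m))"])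
  let ?x = "\<lambda>j. if j < m then (u j, 0) else (0, v (j - m))"
  fix c w
  assume c: "\<exists>j\<in>{..<2 * m}. c j \<noteq> 0" and w: "w = (\<Sum>j\<in>{..<2 * m}. c j *\<^sub>C ?x j)"
    and orth: "\<And>k. k \<in> {..<i} \<Longrightarrow> cinner w (e k, - g k) = 0"
  have "w \<noteq> 0" unfolding w
    by (intro ortho_combination_nonzero[OF _ _ _ c])
      (auto simp: cinner_prod_def orthonormalD[OF u] orthonormalD[OF v] prod_eq_iff
        orthonormal_nonzero[OF u] orthonormal_nonzero[OF v] split: if_splits)
  define X where "X = fst w"
  define Y where "Y = snd w"
  have w': "w = (X, Y)" by (simp add: X_def Y_def)
  have XY: "X = (\<Sum>j\<in>{..<2 * m}. c j *\<^sub>C fst (?x j))" "Y = (\<Sum>j\<in>{..<2 * m}. c j *\<^sub>C snd (?x j))"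
    unfolding X_def Y_def w scaleC_combination_pair by simp_all
  have "ortho_proj u {..<m} (fst (?x j)) = fst (?x j)" for j
    by (simp add: ortho_proj_member[OF u] ortho_proj_zero)
  then have X: "ortho_proj u {..<m} X = X" unfolding XY ortho_proj_sum by simp
  have "ortho_proj v {..<m} (snd (?x j)) = snd (?x j)" if "j < 2 * m" for j
    using that by (simp add: ortho_proj_member[OF v] ortho_proj_zero)
  then have Y: "ortho_proj v {..<m} Y = Y" unfolding XY ortho_proj_sum by simp
  have eg: "cinner X (e k) = cinner Y (g k)" if "k < i" for k
    using orth[of k] that by (simp add: w' cinner_prod_def cinner_minus_right)
  \<comment> \<open>By \<open>eg\<close> the coefficients of \<open>X\<close> and \<open>Y\<close>
    agree for \<open>k < i\<close>, so this part of the form is a nonnegative sum; the remainder is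
    controlled by \<open>s i\<close>.\<close>
  have "cinner (blinfun_apply a (proj i X)) Y = (\<Sum>k<i. complex_of_real (s k * (cmod (cinner X (e k)))\<^sup>2))"
    unfolding ortho_proj_def blinfun_sum_scaleC[OF bounded] scaleR_g[symmetric] cinner_sum_left
    by (intro sum.cong)
      (simp_all add: cinner_scaleC_left cinner_scaleR_left complex_norm_square mult_ac cinner_commute[of "g _" Y] eg del: of_real_power)
  then have "Re (cinner (blinfun_apply a (proj i X)) Y) = (\<Sum>k<i. s k * (cmod (cinner X (e k)))\<^sup>2)" by simp
  then have 1: "0 \<le> Re (cinner (blinfun_apply a (proj i X)) Y)" by (simp add: sum_nonneg nonneg)
  have "cmod (cinner (blinfun_apply a (X - proj i X)) Y) \<le> s i * (norm X * norm Y)"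
    using order_trans[OF Cauchy_Schwarz_cinner mult_right_mono[OF norm_image_rest norm_ge_zero]]
    by (simp add: mult.assoc)
  then have "- (s i * (norm X * norm Y)) \<le> Re (cinner (blinfun_apply a (X - proj i X)) Y)"
    using abs_Re_le_cmod[of "cinner (blinfun_apply a (X - proj i X)) Y"] by linarith
  with 1 have "- (s i * (norm X * norm Y)) \<le> Re (cinner (blinfun_apply a X) Y)"
    by (simp add: blinfun.diff_right cinner_diff_left)
  moreover have "s i * (2 * (norm X * norm Y)) \<le> s i * ((norm X)\<^sup>2 + (norm Y)\<^sup>2)"
    using sum_squares_bound[of "norm X" "norm Y"] by (intro mult_left_mono nonneg) (simp add: mult.assoc)
  ultimately have "(K - s i) * (norm w)\<^sup>2 \<le> Re (cinner (blinfun_apply T w) w)"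
    using dominates[OF X Y] by (simp add: w' norm_prod_square algebra_simps)
  with \<open>w \<noteq> 0\<close> show "w \<noteq> 0 \<and> (K - s i) * norm w \<le> norm (blinfun_apply T w)"
    using norm_ge_of_quadratic_form by blast
qed (use i in auto)

end

section \<open>Rank-one perturbation inside finite-dimensional subspaces\<close>

lemma sum_lessThan_add:
  fixes f :: "nat \<Rightarrow> 'a::comm_monoid_add"
  shows "(\<Sum>i<m + k. f i) = (\<Sum>i<m. f i) + (\<Sum>i<k. f (m + i))"
  by (induction k) (simp_all add: add.assoc)

text \<open>Spectral form of the two-by-two matrix with diagonal \<open>K\<close> and off-diagonal
  \<open>t\<close>: eigenvectors \<open>(1, 1)\<close> and \<open>(1, -1)\<close>, eigenvalues
  \<open>K + t\<close> and \<open>K - t\<close>, and halves from normalisation.\<close>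

lemma dilation_form_identity:
  fixes x y :: complex
  shows "(K + t) / 2 * (cmod (x + y))\<^sup>2 + (K - t) / 2 * (cmod (x - y))\<^sup>2
    = K * ((cmod x)\<^sup>2 + (cmod y)\<^sup>2) + 2 * (t * Re (x * cnj y))"
  by (simp add: cmod_power2) (simp add: power2_eq_square field_simps)

lemma rank_one_form: "Re (cinner (blinfun_apply (rank_one w w) z) z) = (cmod (cinner z w))\<^sup>2"
  by (simp add: cinner_scaleC_left cinner_commute[of w z] complex_mult_cnj cmod_power2)

lemma approx_number_diff_sum_finite_rank:
  fixes u v :: "nat \<Rightarrow> 'a::complex_hilbert"
  assumes u: "orthonormal u m" and v: "orthonormal v m"
    and t: "\<And>j. j < m \<Longrightarrow> 0 \<le> t j"
    and b: "b = (\<Sum>j<m. rank_one (t j *\<^sub>R v j) (u j))"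
    and h: "ortho_proj u {..<m} h = h" and f: "ortho_proj v {..<m} f = f"
  shows "(\<Sum>i<N. \<bar>approx_number (b + rank_one f h) i - approx_number b i\<bar>) \<le> ((norm h)\<^sup>2 + (norm f)\<^sup>2) / 2"
proof -
  define a where "a = b + rank_one f h"
  \<comment> \<open>The sum serves as a common upper bound of the \<open>t j\<close>, so that the
    square root in \<open>q\<close> has a nonnegative argument.\<close>
  define K where "K = (\<Sum>j<m. t j)"
  have K: "0 \<le> t j" "t j \<le> K" if "j < m" for j
    using that t member_le_sum[of j "{..<m}" t] by (auto simp: K_def)
  define p where "p j = sqrt ((K + t j) / 2) *\<^sub>R (u j, v j)" for j
  define q where "q j = sqrt ((K - t j) / 2) *\<^sub>R (u j, - v j)" for j
  \<comment> \<open>On the product, the rank-one operator given by \<open>r\<close> dominates the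
    dilation of \<open>rank_one f h\<close>. Its trace,
    \<open>((norm h)\<^sup>2 + (norm f)\<^sup>2) / 2\<close>, is the bound to be proved.\<close>
  define r where "r = (1 / sqrt 2) *\<^sub>R (h, f)"
  define T where "T = (\<Sum>j<m. rank_one (p j) (p j) + rank_one (q j) (q j)) + rank_one r r"
  have T_compact: "T \<in> compact_ops"
    unfolding T_def by (intro compact_ops_add compact_ops_sum rank_one_compact_ops)
  have b_compact: "b \<in> compact_ops" unfolding b by (intro compact_ops_sum rank_one_compact_ops)
  have a_compact: "a \<in> compact_ops" unfolding a_def by (intro compact_ops_add b_compact rank_one_compact_ops)
  have "nuclear_le T ((\<Sum>j<m. (norm (p j))\<^sup>2 + (norm (q j))\<^sup>2) + (norm r)\<^sup>2)"
    unfolding T_def by (intro nuclear_le_add nuclear_le_sum nuclear_le_rank_one)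
  moreover have "(norm (p j))\<^sup>2 + (norm (q j))\<^sup>2 = 2 * K" if "j < m" for j
    using K[OF that] orthonormal_norm[OF u that] orthonormal_norm[OF v that]
    by (simp add: p_def q_def norm_Pair power_mult_distrib)
  moreover have "(norm r)\<^sup>2 = ((norm h)\<^sup>2 + (norm f)\<^sup>2) / 2"
    by (simp add: r_def norm_Pair power_mult_distrib power_divide)
  ultimately have nuc: "nuclear_le T (m * (2 * K) + ((norm h)\<^sup>2 + (norm f)\<^sup>2) / 2)" by simp
  have b_apply: "blinfun_apply b x = (\<Sum>j<m. (complex_of_real (t j) * cinner x (u j)) *\<^sub>C v j)" for x
    by (simp add: b blinfun.sum_left scaleR_eq_scaleC scaleC_scaleC mult.commute)
  have a_apply: "blinfun_apply a x = blinfun_apply b x + cinner x h *\<^sub>C f" for x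
    by (simp add: a_def blinfun.add_left)
  have form: "Re (cinner (blinfun_apply T (x, y)) (x, y))
      = K * ((norm x)\<^sup>2 + (norm y)\<^sup>2) + 2 * Re (cinner (blinfun_apply b x) y) + (cmod (cinner x h + cinner y f))\<^sup>2 / 2"
    if x: "ortho_proj u {..<m} x = x" and y: "ortho_proj v {..<m} y = y" for x y
  proof -
    have pj: "(cmod (cinner (x, y) (p j)))\<^sup>2 = (K + t j) / 2 * (cmod (cinner x (u j) + cinner y (v j)))\<^sup>2" if "j < m" for j
      using K[OF that] unfolding p_def cinner_scaleR_right by (simp add: cinner_prod_def norm_mult power_mult_distrib)
    have qj: "(cmod (cinner (x, y) (q j)))\<^sup>2 = (K - t j) / 2 * (cmod (cinner x (u j) - cinner y (v j)))\<^sup>2" if "j < m" for j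
      using K[OF that] unfolding q_def cinner_scaleR_right by (simp add: cinner_prod_def norm_mult power_mult_distrib cinner_minus_right)
    have rj: "(cmod (cinner (x, y) r))\<^sup>2 = (cmod (cinner x h + cinner y f))\<^sup>2 / 2"
      unfolding r_def cinner_scaleR_right by (simp add: cinner_prod_def norm_mult power_mult_distrib norm_divide power_divide)
    have "Re (cinner (blinfun_apply T (x, y)) (x, y))
        = (\<Sum>j<m. (cmod (cinner (x, y) (p j)))\<^sup>2 + (cmod (cinner (x, y) (q j)))\<^sup>2) + (cmod (cinner (x, y) r))\<^sup>2"
      unfolding T_def blinfun.add_left blinfun.sum_left cinner_add_left cinner_sum_left plus_complex.simps Re_sum rank_one_form ..
    also have "(\<Sum>j<m. (cmod (cinner (x, y) (p j)))\<^sup>2 + (cmod (cinner (x, y) (q j)))\<^sup>2)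
        = (\<Sum>j<m. K * ((cmod (cinner x (u j)))\<^sup>2 + (cmod (cinner y (v j)))\<^sup>2)
            + 2 * (t j * Re (cinner x (u j) * cnj (cinner y (v j)))))"
      by (intro sum.cong refl) (simp only: lessThan_iff pj qj dilation_form_identity)
    also have "\<dots> = K * ((\<Sum>j<m. (cmod (cinner x (u j)))\<^sup>2) + (\<Sum>j<m. (cmod (cinner y (v j)))\<^sup>2))
        + 2 * (\<Sum>j<m. t j * Re (cinner x (u j) * cnj (cinner y (v j))))"
      by (simp add: sum.distrib sum_distrib_left distrib_left)
    also have "(\<Sum>j<m. (cmod (cinner x (u j)))\<^sup>2) = (norm x)\<^sup>2"
      using norm_ortho_proj[OF orthonormal_ortho_family[OF u], of x] x by simp
    also have "(\<Sum>j<m. (cmod (cinner y (v j)))\<^sup>2) = (norm y)\<^sup>2"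
      using norm_ortho_proj[OF orthonormal_ortho_family[OF v], of y] y by simp
    also have "(\<Sum>j<m. t j * Re (cinner x (u j) * cnj (cinner y (v j)))) = Re (cinner (blinfun_apply b x) y)"
      unfolding b_apply cinner_sum_left Re_sum
      by (intro sum.cong) (simp_all add: cinner_scaleC_left cinner_commute[of "v _" y] mult.assoc)
    finally show ?thesis unfolding rj .
  qed
  have dominated: "dominated_dilation c e s T u v m K"
    if c: "c = a \<or> c = b" and sch: "schmidt_system c e s" for c e s
  proof -
    interpret schmidt_system c e s by (rule sch)
    have b_source: "blinfun_apply b (ortho_proj u {..<m} x) = blinfun_apply b x" for x
      unfolding b_apply using orthonormal_ortho_family[OF u] by (intro sum.cong) (simp_all add: cinner_ortho_proj)
    have b_target: "ortho_proj v {..<m} (blinfun_apply b x) = blinfun_apply b x" for x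
      unfolding b_apply ortho_proj_sum by (intro sum.cong) (simp_all add: ortho_proj_member[OF v])
    show ?thesis
    proof
      show "blinfun_apply c (ortho_proj u {..<m} x) = blinfun_apply c x" for x
        using c by (auto simp: a_apply b_source ortho_proj_symmetric h)
      show "ortho_proj v {..<m} (blinfun_apply c x) = blinfun_apply c x" for x
        using c ortho_proj_sum[of v "{..<m}" "\<lambda>_. cinner x h" "\<lambda>_. f" "{()}"]
        by (auto simp: a_apply ortho_proj_add b_target f)
      fix x y assume xy: "ortho_proj u {..<m} x = x" "ortho_proj v {..<m} y = y"
      \<comment> \<open>The term discarded is half the squared modulus of the difference. For
        \<open>c = b\<close> it suffices that the square contributed by \<open>r\<close> is
        nonnegative.\<close>
      have "2 * Re (cinner x h * cnj (cinner y f)) \<le> (cmod (cinner x h + cinner y f))\<^sup>2 / 2"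
      proof -
        have "(cmod (cinner x h + cinner y f))\<^sup>2 - (cmod (cinner x h - cinner y f))\<^sup>2 = 4 * Re (cinner x h * cnj (cinner y f))"
          by (simp add: cmod_power2) (simp add: power2_eq_square algebra_simps)
        then show ?thesis using zero_le_power2[of "cmod (cinner x h - cinner y f)"] by linarith
      qed
      then show "K * ((norm x)\<^sup>2 + (norm y)\<^sup>2) + 2 * Re (cinner (blinfun_apply c x) y)
          \<le> Re (cinner (blinfun_apply T (x, y)) (x, y))"
        unfolding form[OF xy] using c
        by (auto simp: a_apply cinner_add_left cinner_scaleC_left cinner_commute[of f y])
    qed (rule u v)+
  qed
  have bounds: "K + approx_number c i \<le> approx_number T i" "K - approx_number c i \<le> approx_number T (2 * m - Suc i)"
    "ortho_proj v {..<m} (blinfun_apply c x) = blinfun_apply c x"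
    if c: "c = a \<or> c = b" and i: "i < m" for c i x
  proof -
    obtain e s where es: "schmidt_system c e s" using schmidt_system_exists a_compact b_compact c by metis
    interpret dominated_dilation c e s T u v m K by (rule dominated[OF c es])
    show "K + approx_number c i \<le> approx_number T i" "K - approx_number c i \<le> approx_number T (2 * m - Suc i)"
      using approx_number_upper_half[OF i] approx_number_lower_half[OF i] by (simp_all add: approx_number_eq)
    show "ortho_proj v {..<m} (blinfun_apply c x) = blinfun_apply c x" by (rule target)
  qed
  \<comment> \<open>Each index \<open>i\<close> is paired with \<open>2 * m - Suc i\<close>. Taking
    the better of the bounds for \<open>a\<close> and \<open>b\<close> at either end gives
    \<open>K\<close> plus the larger and \<open>K\<close> minus the smaller \<open>i\<close>-th
    value. The pairs exhaust the indices below \<open>2 * m\<close>, so the trace bound applies to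
    their sum.\<close>
  have "m * (2 * K) + (\<Sum>i<m. \<bar>approx_number a i - approx_number b i\<bar>)
      = (\<Sum>i<m. 2 * K + \<bar>approx_number a i - approx_number b i\<bar>)" by (simp add: sum.distrib)
  also have "\<dots> \<le> (\<Sum>i<m. approx_number T i + approx_number T (2 * m - Suc i))"
  proof (intro sum_mono)
    fix i assume "i \<in> {..<m}"
    then have "i < m" by simp
    show "2 * K + \<bar>approx_number a i - approx_number b i\<bar> \<le> approx_number T i + approx_number T (2 * m - Suc i)"
      using bounds(1,2)[of a i] bounds(1,2)[of b i] \<open>i < m\<close> by (auto simp: abs_if)
  qed
  also have "\<dots> = (\<Sum>i<m. approx_number T i) + (\<Sum>i<m. approx_number T (m + (m - Suc i)))"
    unfolding sum.distrib by (intro arg_cong2[where f = "(+)"] sum.cong refl arg_cong2[where f = approx_number]) auto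
  also have "\<dots> = (\<Sum>i<m + m. approx_number T i)"
    unfolding sum.nat_diff_reindex[of "\<lambda>i. approx_number T (m + i)" m] sum_lessThan_add ..
  also have "\<dots> \<le> m * (2 * K) + ((norm h)\<^sup>2 + (norm f)\<^sup>2) / 2"
    by (rule sum_approx_number_le_nuclear[OF T_compact nuc])
  finally have main: "(\<Sum>i<m. \<bar>approx_number a i - approx_number b i\<bar>) \<le> ((norm h)\<^sup>2 + (norm f)\<^sup>2) / 2" by simp
  \<comment> \<open>Both ranges lie in the span of the \<open>m\<close> vectors \<open>v j\<close>,
    so indices from \<open>m\<close> on contribute nothing.\<close>
  have zero: "approx_number c i = 0" if c: "c = a \<or> c = b" and i: "m \<le> i" for c i
  proof -
    have "blinfun_apply c x \<in> cspan (v ` {..<m})" for x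
    proof -
      obtain e s where es: "schmidt_system c e s" using schmidt_system_exists a_compact b_compact c by metis
      interpret dominated_dilation c e s T u v m K by (rule dominated[OF c es])
      show ?thesis
        by (subst target[symmetric], unfold ortho_proj_def, intro complex_vector.span_sum complex_vector.span_scale) (auto intro: complex_vector.span_base)
    qed
    then have "approx_number c i \<le> norm (c - c)"
      using c i card_image_le[of "{..<m}" v] a_compact b_compact
      by (intro approx_number_le[of _ "v ` {..<m}"]) (auto intro: compact_ops_bounded)
    then show ?thesis using approx_number_nonneg[of c i] by simp
  qed
  have "(\<Sum>i<N. \<bar>approx_number a i - approx_number b i\<bar>) \<le> (\<Sum>i<N + m. \<bar>approx_number a i - approx_number b i\<bar>)"
    by (intro sum_mono2) auto
  also have "\<dots> = (\<Sum>i<m. \<bar>approx_number a i - approx_number b i\<bar>)"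
    unfolding add.commute[of N m] sum_lessThan_add using zero by simp
  finally show ?thesis using main by (simp add: a_def)
qed

section \<open>Perturbation of compact operators\<close>

text \<open>One Gram-Schmidt step; the last clause records that the span grows.\<close>

lemma orthonormal_extend:
  fixes u :: "nat \<Rightarrow> 'a::complex_hilbert"
  assumes u: "orthonormal u n" and x: "ortho_proj u {..<n} x \<noteq> x"
  shows "\<exists>u'. orthonormal u' (Suc n) \<and> (\<forall>j<n. u' j = u j) \<and> ortho_proj u' {..<Suc n} x = x \<and>
    (\<forall>y. ortho_proj u {..<n} y = y \<longrightarrow> ortho_proj u' {..<Suc n} y = y)"
proof -
  define z where "z = x - ortho_proj u {..<n} x"
  define w where "w = (1 / norm z) *\<^sub>R z"
  define u' where "u' = u(n := w)"
  have z: "norm z > 0" using x by (simp add: z_def)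
  have zu: "cinner z (u j) = 0" if "j < n" for j
    using that by (simp add: z_def cinner_ortho_proj_rest orthonormal_ortho_family[OF u])
  have wu: "cinner w (u j) = 0" "cinner (u j) w = 0" if "j < n" for j
    using zu[OF that] cinner_commute[of "u j" w] by (simp_all add: w_def cinner_scaleR_left)
  have "cinner w w = 1" using z by (simp add: w_def cinner_self)
  then have "orthonormal u' (Suc n)"
    using orthonormalD[OF u] wu by (auto simp: orthonormal_def u'_def less_Suc_eq)
  moreover have proj: "ortho_proj u' {..<Suc n} y = ortho_proj u {..<n} y + cinner y w *\<^sub>C w" for y
    by (simp add: ortho_proj_def u'_def)
  have pz: "cinner (ortho_proj u {..<n} y) z = 0" for y
    using zu by (simp add: ortho_proj_def cinner_sum_left cinner_scaleC_left cinner_commute[of "u _" z])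
  have "cinner y w = 0" if "ortho_proj u {..<n} y = y" for y
    using pz[of y] that by (simp add: w_def cinner_scaleR_right)
  then have "ortho_proj u' {..<Suc n} y = y" if "ortho_proj u {..<n} y = y" for y
    using that by (simp add: proj)
  moreover have "cinner x z = complex_of_real ((norm z)\<^sup>2)"
    using pz[of x] cinner_diff_left[of x "ortho_proj u {..<n} x" z]
    by (simp add: z_def[symmetric] cinner_self)
  then have "cinner x w = complex_of_real (norm z)"
    using z by (simp add: w_def cinner_scaleR_right power2_eq_square)
  then have "cinner x w *\<^sub>C w = norm z *\<^sub>R w" by (simp add: scaleR_eq_scaleC)
  then have "cinner x w *\<^sub>C w = z" using z by (simp add: w_def)
  then have "ortho_proj u' {..<Suc n} x = x" unfolding proj by (simp add: z_def)
  ultimately show ?thesis by (intro exI[of _ u']) (simp add: u'_def)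
qed

lemma orthonormal_basis_maximal:
  fixes u v :: "nat \<Rightarrow> 'a::complex_hilbert"
  assumes u: "\<And>x. ortho_proj u {..<n} x = x" and v: "orthonormal v m"
  shows "m \<le> n"
proof (rule ccontr)
  assume "\<not> m \<le> n"
  then have "card {..<n} < card {..<m}" by simp
  from homogeneous_system_nontrivial_solution[OF _ _ this, of "\<lambda>i j. cinner (v j) (u i)"]
  obtain c where c: "\<exists>j\<in>{..<m}. c j \<noteq> 0" "\<And>i. i < n \<Longrightarrow> (\<Sum>j<m. cinner (v j) (u i) * c j) = 0" by auto
  define z where "z = (\<Sum>j<m. c j *\<^sub>C v j)"
  have "cinner z (u i) = 0" if "i < n" for i
    using c(2)[OF that] by (simp add: z_def cinner_sum_left cinner_scaleC_left mult.commute)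
  then have "ortho_proj u {..<n} z = 0" by (simp add: ortho_proj_def)
  then have "z = 0" using u by simp
  moreover have "z \<noteq> 0" unfolding z_def
    by (rule ortho_combination_nonzero[OF _ _ _ c(1)]) (auto simp: orthonormalD[OF v] orthonormal_nonzero[OF v])
  ultimately show False by simp
qed

text \<open>The dilation argument needs orthonormal systems of equal length on both sides. So even
  if only one of \<open>h\<close> and \<open>f\<close> lies outside its span, both systems have to
  grow by a vector.\<close>

lemma orthonormal_extend_pair:
  fixes u v :: "nat \<Rightarrow> 'a::complex_hilbert"
  assumes u: "orthonormal u n" and v: "orthonormal v n"
  obtains m u' v' where "n \<le> m" "orthonormal u' m" "orthonormal v' m"
    "\<And>j. j < n \<Longrightarrow> u' j = u j" "\<And>j. j < n \<Longrightarrow> v' j = v j"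
    "ortho_proj u' {..<m} h = h" "ortho_proj v' {..<m} f = f"
proof (cases "ortho_proj u {..<n} h = h \<and> ortho_proj v {..<n} f = f")
  case True
  then show ?thesis by (intro that[of n u v] u v) simp_all
next
  case False
  \<comment> \<open>If \<open>p\<close> already spanned the whole space, no longer orthonormal
    system could exist, yet \<open>q\<close> of the same length is extendable. So the side whose
    target is already covered still has a new direction to offer.\<close>
  have ex: "\<exists>x. ortho_proj p {..<n} x \<noteq> x \<and> (ortho_proj p {..<n} k = k \<or> x = k)"
    if q: "orthonormal q n" and kl: "ortho_proj p {..<n} k \<noteq> k \<or> ortho_proj q {..<n} l \<noteq> l"
    for p q :: "nat \<Rightarrow> 'a" and k l
  proof (cases "ortho_proj p {..<n} k = k")
    case True
    with kl have "ortho_proj q {..<n} l \<noteq> l" by simp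
    from orthonormal_extend[OF q this] obtain q' :: "nat \<Rightarrow> 'a" where "orthonormal q' (Suc n)" by (elim exE conjE) (rule that)
    then have "\<not> (\<forall>x. ortho_proj p {..<n} x = x)"
      using orthonormal_basis_maximal[of p n q' "Suc n"] by auto
    then show ?thesis using True by auto
  qed auto
  obtain x where x: "ortho_proj u {..<n} x \<noteq> x" "ortho_proj u {..<n} h = h \<or> x = h"
    using ex[OF v, of u h f] False by blast
  obtain y where y: "ortho_proj v {..<n} y \<noteq> y" "ortho_proj v {..<n} f = f \<or> y = f"
    using ex[OF u, of v f h] False by blast
  obtain u' where u': "orthonormal u' (Suc n)" "\<forall>j<n. u' j = u j"
    "ortho_proj u' {..<Suc n} x = x"
    "\<forall>y. ortho_proj u {..<n} y = y \<longrightarrow> ortho_proj u' {..<Suc n} y = y"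
    using orthonormal_extend[OF u x(1)] by (elim exE conjE) (rule that)
  obtain v' where v': "orthonormal v' (Suc n)" "\<forall>j<n. v' j = v j"
    "ortho_proj v' {..<Suc n} y = y"
    "\<forall>y. ortho_proj v {..<n} y = y \<longrightarrow> ortho_proj v' {..<Suc n} y = y"
    using orthonormal_extend[OF v y(1)] by (elim exE conjE) (rule that)
  have "ortho_proj u' {..<Suc n} h = h" "ortho_proj v' {..<Suc n} f = f"
    using x(2) y(2) u'(3) v'(3) u'(4)[rule_format, of h] v'(4)[rule_format, of f] by metis+
  then show ?thesis
    using that[of "Suc n" u' v'] u'(1,2) v'(1,2) by simp
qed

section \<open>From finite-rank to compact operators\<close>

lemma (in schmidt_system) truncation_index:
  assumes "r > 0"
  obtains n where "s n \<le> r" "\<And>j. j < n \<Longrightarrow> r < s j"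
proof -
  have "eventually (\<lambda>n. s n < r) sequentially" using lim assms by (rule order_tendstoD)
  then have "\<exists>n. s n \<le> r" by (auto simp: eventually_sequentially intro: less_imp_le)
  then have "s (LEAST n. s n \<le> r) \<le> r" by (rule LeastI_ex)
  then show ?thesis using that[of "LEAST n. s n \<le> r"] not_less_Least by (metis not_le)
qed

lemma (in schmidt_system) approx_number_rank_one_perturbation_aux:
  "(\<Sum>i<N. \<bar>approx_number (a + rank_one f h) i - approx_number a i\<bar>) \<le> ((norm h)\<^sup>2 + (norm f)\<^sup>2) / 2"
proof (rule field_le_epsilon)
  fix d :: real assume d: "d > 0"
  \<comment> \<open>Replacing \<open>a\<close> by its truncation costs \<open>2 * r\<close> for each
    of the \<open>N\<close> indices; \<open>N + 1\<close> in the denominator covers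
    \<open>N = 0\<close>.\<close>
  define k where "k = d / (N + 1)"
  define r where "r = k / 2"
  have "N * (2 * r) = N * k" by (simp add: r_def)
  also have "\<dots> = d * (N / (N + 1))" by (simp add: k_def)
  also have "\<dots> \<le> d * 1" using d by (intro mult_left_mono) auto
  finally have r: "r > 0" "N * (2 * r) \<le> d" using d by (auto simp: r_def k_def)
  obtain n where n: "s n \<le> r" "\<And>j. j < n \<Longrightarrow> r < s j" using truncation_index[OF r(1)] by metis
  then have pos: "s j > 0" if "j < n" for j using that r(1) by (meson less_trans)
  have "orthonormal e n" using pos by (auto simp: orthonormal_def inner)
  moreover have "orthonormal g n"
  proof -
    have "norm (g j) = 1" if "j < n" for j using pos[OF that] by (simp add: g_def norm_image)
    moreover have "cinner (g i) (g j) = 0" if "i \<noteq> j" for i j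
      using ortho_family_g[of UNIV] that by (simp add: ortho_family_def)
    ultimately show ?thesis by (auto simp: orthonormal_def cinner_self)
  qed
  ultimately obtain m u v where m: "n \<le> m" and u: "orthonormal u m" and v: "orthonormal v m"
    and ext: "\<And>j. j < n \<Longrightarrow> u j = e j" "\<And>j. j < n \<Longrightarrow> v j = g j"
    and hf: "ortho_proj u {..<m} h = h" "ortho_proj v {..<m} f = f"
    by (rule orthonormal_extend_pair[of e n g h f]) (rule that)
  \<comment> \<open>The vectors added to absorb \<open>h\<close> and \<open>f\<close> get
    coefficient 0 and leave the truncation unchanged.\<close>
  define t where "t j = (if j < n then s j else 0)" for j
  define b where "b = (\<Sum>j<n. rank_one (blinfun_apply a (e j)) (e j))"
  have "b = (\<Sum>j<n. rank_one (t j *\<^sub>R v j) (u j))"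
    unfolding b_def by (intro sum.cong) (simp_all add: t_def ext scaleR_g)
  also have "\<dots> = (\<Sum>j<m. rank_one (t j *\<^sub>R v j) (u j))"
    using m by (intro sum.mono_neutral_left) (auto simp: t_def intro!: blinfun_eqI)
  finally have b: "b = (\<Sum>j<m. rank_one (t j *\<^sub>R v j) (u j))" .
  have t0: "0 \<le> t j" for j by (simp add: t_def nonneg)
  have ab: "norm (a - b) \<le> r" unfolding b_def using norm_truncation[of n] n(1) by simp
  have "\<bar>approx_number (a + rank_one f h) i - approx_number a i\<bar>
      \<le> \<bar>approx_number (b + rank_one f h) i - approx_number b i\<bar> + 2 * r" for i
    using abs_approx_number_diff[of "a + rank_one f h" i "b + rank_one f h"] abs_approx_number_diff[of a i b] ab
    by simp
  then have "(\<Sum>i<N. \<bar>approx_number (a + rank_one f h) i - approx_number a i\<bar>)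
      \<le> (\<Sum>i<N. \<bar>approx_number (b + rank_one f h) i - approx_number b i\<bar> + 2 * r)" by (rule sum_mono)
  also have "\<dots> = (\<Sum>i<N. \<bar>approx_number (b + rank_one f h) i - approx_number b i\<bar>) + N * (2 * r)"
    by (simp add: sum.distrib)
  also have "\<dots> \<le> ((norm h)\<^sup>2 + (norm f)\<^sup>2) / 2 + d"
    by (intro add_mono approx_number_diff_sum_finite_rank[OF u v t0 b hf] r(2))
  finally show "(\<Sum>i<N. \<bar>approx_number (a + rank_one f h) i - approx_number a i\<bar>) \<le> ((norm h)\<^sup>2 + (norm f)\<^sup>2) / 2 + d" .
qed

text \<open>Moving a factor from \<open>h\<close> to \<open>f\<close> leaves
  \<open>rank_one f h\<close> unchanged; the factor \<open>c\<close> balances the two norms, which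
  turns the arithmetic mean of their squares into the product.\<close>

lemma approx_number_rank_one_perturbation:
  assumes "a \<in> compact_ops"
  shows "(\<Sum>i<N. \<bar>approx_number (a + rank_one f h) i - approx_number a i\<bar>) \<le> norm f * norm h"
proof -
  obtain e s where "schmidt_system a e s" using schmidt_system_exists assms by blast
  then interpret schmidt_system a e s .
  show ?thesis
  proof (cases "f = 0 \<or> h = 0")
    case True
    then have "rank_one f h = 0" by (auto intro!: blinfun_eqI)
    then show ?thesis by simp
  next
    case False
    define c where "c = sqrt (norm h / norm f)"
    have c: "c > 0" "c\<^sup>2 = norm h / norm f" using False by (auto simp: c_def)
    have "rank_one (c *\<^sub>R f) ((1 / c) *\<^sub>R h) = rank_one f h"
      using c by (intro blinfun_eqI) (simp add: cinner_scaleR_right scaleR_eq_scaleC scaleC_scaleC cinner_scaleC_right)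
    moreover have "((norm ((1 / c) *\<^sub>R h))\<^sup>2 + (norm (c *\<^sub>R f))\<^sup>2) / 2 = norm f * norm h"
      using False by (simp add: power_mult_distrib power_divide c) (simp add: power2_eq_square)
    ultimately show ?thesis
      using approx_number_rank_one_perturbation_aux[where N = N and f = "c *\<^sub>R f" and h = "(1 / c) *\<^sub>R h"] by simp
  qed
qed

lemma approx_number_finite_rank_perturbation:
  fixes f h :: "nat \<Rightarrow> 'a::complex_hilbert"
  assumes "a \<in> compact_ops"
  shows "(\<Sum>i<N. \<bar>approx_number (a + (\<Sum>j<n. rank_one (f j) (h j))) i - approx_number a i\<bar>)
    \<le> (\<Sum>j<n. norm (f j) * norm (h j))"
proof (induction n)
  case (Suc n)
  let ?b = "a + (\<Sum>j<n. rank_one (f j) (h j))"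
  have b: "?b \<in> compact_ops" by (intro compact_ops_add compact_ops_sum rank_one_compact_ops assms)
  have "(\<Sum>i<N. \<bar>approx_number (a + (\<Sum>j<Suc n. rank_one (f j) (h j))) i - approx_number a i\<bar>)
      \<le> (\<Sum>i<N. \<bar>approx_number (?b + rank_one (f n) (h n)) i - approx_number ?b i\<bar> + \<bar>approx_number ?b i - approx_number a i\<bar>)"
    by (intro sum_mono) (simp add: add.assoc)
  also have "\<dots> \<le> norm (f n) * norm (h n) + (\<Sum>j<n. norm (f j) * norm (h j))"
    unfolding sum.distrib by (intro add_mono approx_number_rank_one_perturbation Suc.IH b)
  finally show ?case by simp
qed simp

text \<open>Soft thresholding of \<open>a - b\<close>: a finite-rank \<open>d\<close> carries the
  excesses of its singular values over \<open>t\<close>, and what remains has norm at most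
  \<open>t\<close>. The former is charged to the trace-norm estimate, the latter to the Lipschitz
  estimate.\<close>

lemma approx_number_diff_excess_sum:
  assumes a: "a \<in> compact_ops" and b: "b \<in> compact_ops" and t: "t > 0"
  shows "\<exists>n. (\<Sum>i<N. max 0 (\<bar>approx_number a i - approx_number b i\<bar> - t))
    \<le> (\<Sum>j<n. max 0 (approx_number (a - b) j - t))"
proof -
  define c where "c = a - b"
  obtain e s where "schmidt_system c e s" using schmidt_system_exists[of c] compact_ops_diff[OF a b] c_def by metis
  then interpret schmidt_system c e s .
  obtain n where n: "s n \<le> t" using truncation_index[OF t] by metis
  \<comment> \<open>Chosen so that \<open>w j * s j\<close> is the excess of \<open>s j\<close> over
    \<open>t\<close>. If \<open>s j = 0\<close> the quotient is 0 and \<open>w j = 1\<close>, but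
    then \<open>e j\<close> vanishes.\<close>
  define w where "w j = max 0 (1 - t / s j)" for j
  define d where "d = (\<Sum>j<n. rank_one (w j *\<^sub>R blinfun_apply c (e j)) (e j))"
  have w: "(1 - w j) * s j = min t (s j)" for j
    using nonneg[of j] t by (cases "s j = 0") (auto simp: w_def max_def min_def field_simps)
  have "norm (c - d) \<le> t"
  proof (rule norm_blinfun_bound)
    fix x
    define z where "z = x - proj n x"
    have d_apply: "blinfun_apply d x = (\<Sum>j<n. complex_of_real (w j) *\<^sub>C cinner x (e j) *\<^sub>C blinfun_apply c (e j))"
      by (simp add: d_def blinfun.sum_left scaleR_eq_scaleC scaleC_scaleC mult.commute)
    have "blinfun_apply (c - d) x = blinfun_apply c z + (\<Sum>j<n. (complex_of_real (1 - w j) * cinner x (e j)) *\<^sub>C blinfun_apply c (e j))"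
      unfolding z_def ortho_proj_def blinfun.diff_left blinfun.diff_right blinfun_sum_scaleC[OF bounded] d_apply
      by (simp add: left_diff_distrib complex_vector.scale_left_diff_distrib sum_subtractf scaleC_scaleC)
    moreover have "cinner (blinfun_apply c z) (blinfun_apply c (e j)) = 0" if "j < n" for j
    proof -
      have "cinner (e j) z = 0"
        using cinner_ortho_proj_rest[OF ortho_family_e, of "{..<n}" j x] that by (subst cinner_commute) (simp add: z_def)
      then show ?thesis by (subst cinner_commute) (simp add: image_inner)
    qed
    then have "cinner (blinfun_apply c z) (\<Sum>j<n. (complex_of_real (1 - w j) * cinner x (e j)) *\<^sub>C blinfun_apply c (e j)) = 0"
      by (simp add: cinner_sum_right cinner_scaleC_right)
    ultimately have "(norm (blinfun_apply (c - d) x))\<^sup>2 = (norm (blinfun_apply c z))\<^sup>2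
        + (norm (\<Sum>j<n. (complex_of_real (1 - w j) * cinner x (e j)) *\<^sub>C blinfun_apply c (e j)))\<^sup>2"
      by (simp add: norm_add_square_orthogonal)
    also have "(norm (\<Sum>j<n. (complex_of_real (1 - w j) * cinner x (e j)) *\<^sub>C blinfun_apply c (e j)))\<^sup>2
        = (\<Sum>j<n. (cmod (complex_of_real (1 - w j) * cinner x (e j)))\<^sup>2 * (s j)\<^sup>2)"
      by (rule trans[OF norm_sum_square_orthogonal]) (auto simp: image_orth norm_image)
    also have "\<dots> = (\<Sum>j<n. (cmod (cinner x (e j)))\<^sup>2 * ((1 - w j) * s j)\<^sup>2)"
      unfolding norm_mult power_mult_distrib norm_of_real power2_abs by (simp only: mult_ac)
    also have "\<dots> \<le> (\<Sum>j<n. (cmod (cinner x (e j)))\<^sup>2 * t\<^sup>2)"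
      unfolding w using nonneg t by (intro sum_mono mult_left_mono power_mono) auto
    also have "norm (blinfun_apply c z) \<le> s n * norm z"
      by (rule bound) (simp add: z_def cinner_ortho_proj_rest ortho_family_e)
    then have "norm (blinfun_apply c z) \<le> t * norm z"
      using mult_right_mono[OF n norm_ge_zero, of z] by simp
    then have "(norm (blinfun_apply c z))\<^sup>2 \<le> (t * norm z)\<^sup>2" by (rule power_mono) simp
    finally have "(norm (blinfun_apply (c - d) x))\<^sup>2
        \<le> t\<^sup>2 * ((\<Sum>j<n. (cmod (cinner x (e j)))\<^sup>2) + (norm z)\<^sup>2)"
      by (simp add: sum_distrib_left power_mult_distrib algebra_simps)
    also have "\<dots> = (t * norm x)\<^sup>2"
      using norm_square_ortho_split[OF ortho_family_e, of "{..<n}" x] by (simp add: power_mult_distrib z_def)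
    finally show "norm (blinfun_apply (c - d) x) \<le> t * norm x"
      by (rule power2_le_imp_le) (use t in simp)
  qed (use t in simp)
  then have ad: "norm (a - (b + d)) \<le> t" by (simp add: c_def diff_diff_eq)
  \<comment> \<open>Replacing \<open>a\<close> by \<open>b + d\<close> moves each approximation
    number by at most \<open>t\<close>, which is exactly what the threshold forgives.\<close>
  have "max 0 (\<bar>approx_number a i - approx_number b i\<bar> - t) \<le> \<bar>approx_number (b + d) i - approx_number b i\<bar>" for i
    using abs_approx_number_diff[of a i "b + d"] ad by simp
  then have "(\<Sum>i<N. max 0 (\<bar>approx_number a i - approx_number b i\<bar> - t))
      \<le> (\<Sum>i<N. \<bar>approx_number (b + d) i - approx_number b i\<bar>)" by (rule sum_mono)
  also have "\<dots> \<le> (\<Sum>j<n. norm (w j *\<^sub>R blinfun_apply c (e j)) * norm (e j))"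
    unfolding d_def by (rule approx_number_finite_rank_perturbation[OF b])
  also have "\<dots> = (\<Sum>j<n. max 0 (approx_number (a - b) j - t))"
  proof (intro sum.cong refl)
    fix j
    show "norm (w j *\<^sub>R blinfun_apply c (e j)) * norm (e j) = max 0 (approx_number (a - b) j - t)"
      using nonneg[of j] t w[of j]
      by (cases "s j = 0") (auto simp: c_def[symmetric] approx_number_eq norm_image norm_e w_def max_def min_def field_simps)
  qed
  finally show ?thesis by blast
qed

section \<open>From threshold sums to sums of powers\<close>

lemma powr_eq_nn_integral:
  fixes x p :: real
  assumes "0 \<le> x" "1 < p"
  shows "(\<integral>\<^sup>+t. ennreal (p * (p - 1) * t powr (p - 2)) * indicator {0<..} t * ennreal (x - t) \<partial>lborel) = ennreal (x powr p)"
proof -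
  \<comment> \<open>Antiderivative of \<open>f\<close>. The weight
    \<open>p * (p - 1) * t powr (p - 2)\<close> is the second derivative of \<open>t powr p\<close>,
    so the identity is Taylor's formula at 0 with integral remainder. Outside the interval from 0 to
    \<open>x\<close> the integrand vanishes, as \<open>ennreal\<close> sends negative reals to
    0.\<close>
  define F where "F t = p * x * t powr (p - 1) - (p - 1) * t powr p" for t
  define f where "f t = p * (p - 1) * t powr (p - 2) * (x - t)" for t
  have "(f has_integral (F x - F 0)) {0..x}"
  \<comment> \<open>For \<open>p < 2\<close> the derivative is unbounded near 0, but
    \<open>F\<close> is still continuous there.\<close>
  proof (rule fundamental_theorem_of_calculus_interior)
    show "continuous_on {0..x} F"
      unfolding F_def using assms by (intro continuous_intros continuous_on_powr') auto
    fix t assume t: "t \<in> {0<..<x}"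
    have "t powr (p - 1) = t powr (p - 2) * t"
      using t powr_add[of t "p - 2" 1] by simp
    then show "(F has_vector_derivative f t) (at t)"
      unfolding F_def f_def has_real_derivative_iff_has_vector_derivative[symmetric]
      using t by (auto intro!: derivative_eq_intros simp: algebra_simps)
  qed (use assms in auto)
  moreover have "F x - F 0 = x powr p"
    using assms powr_add[of x "p - 1" 1] by (cases "x = 0") (auto simp: F_def algebra_simps)
  ultimately have I: "(f has_integral x powr p) {0..x}" by simp
  have "(\<integral>\<^sup>+t. ennreal (p * (p - 1) * t powr (p - 2)) * indicator {0<..} t * ennreal (x - t) \<partial>lborel)
      = (\<integral>\<^sup>+t. ennreal (indicator {0..x} t * f t) \<partial>lborel)"
  proof (intro nn_integral_cong)
    fix t
    show "ennreal (p * (p - 1) * t powr (p - 2)) * indicator {0<..} t * ennreal (x - t) = ennreal (indicator {0..x} t * f t)"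
      using assms by (auto simp: f_def indicator_def ennreal_mult[symmetric] ennreal_neg)
  qed
  also have "\<dots> = ennreal (x powr p)"
    by (rule nn_integral_has_integral_lebesgue[OF _ I]) (use assms in \<open>auto simp: f_def\<close>)
  finally show ?thesis .
qed

text \<open>Each power is a mixture of positive parts \<open>ennreal (x n - t)\<close> with a
  nonnegative weight independent of \<open>n\<close>. Exchanging sum and integral reduces the claim
  to the comparison of threshold sums for each \<open>t\<close>.\<close>

lemma suminf_powr_le:
  fixes x y :: "nat \<Rightarrow> real"
  assumes x: "\<And>n. 0 \<le> x n" and y: "\<And>n. 0 \<le> y n" and p: "1 \<le> p"
    and excess: "\<And>t N. t > 0 \<Longrightarrow> \<exists>n. (\<Sum>i<N. max 0 (x i - t)) \<le> (\<Sum>j<n. max 0 (y j - t))"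
  shows "(\<Sum>n. ennreal (x n powr p)) \<le> (\<Sum>n. ennreal (y n powr p))"
proof -
  have max: "ennreal (max 0 r) = ennreal r" for r by (cases "r \<ge> 0") (auto simp: ennreal_neg)
  have ex: "(\<Sum>i. ennreal (x i - t)) \<le> (\<Sum>j. ennreal (y j - t))" if t: "t > 0" for t
  proof (rule suminf_le_const)
    fix N
    obtain n where n: "(\<Sum>i<N. max 0 (x i - t)) \<le> (\<Sum>j<n. max 0 (y j - t))" using excess[OF t] by blast
    have "(\<Sum>i<N. ennreal (x i - t)) = ennreal (\<Sum>i<N. max 0 (x i - t))"
      by (subst max[symmetric], subst sum_ennreal) auto
    also have "\<dots> \<le> ennreal (\<Sum>j<n. max 0 (y j - t))" using n by (rule ennreal_leI)
    also have "\<dots> = (\<Sum>j<n. ennreal (max 0 (y j - t)))" by (subst sum_ennreal) auto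
    also have "\<dots> = (\<Sum>j<n. ennreal (y j - t))" by (simp only: max)
    also have "\<dots> \<le> (\<Sum>j. ennreal (y j - t))" by (intro sum_le_suminf) auto
    finally show "(\<Sum>i<N. ennreal (x i - t)) \<le> (\<Sum>j. ennreal (y j - t))" .
  qed simp
  show ?thesis
  proof (cases "p = 1")
    case True
    \<comment> \<open>For \<open>p = 1\<close> the weight degenerates to 0, so the threshold is sent
      to 0 instead: on the first \<open>N\<close> terms it costs at most
      \<open>N * t\<close>.\<close>
    have "(\<Sum>n. ennreal (x n)) \<le> (\<Sum>n. ennreal (y n))"
    proof (rule suminf_le_const)
      fix N
      show "(\<Sum>i<N. ennreal (x i)) \<le> (\<Sum>n. ennreal (y n))"
      proof (rule ennreal_le_epsilon)
        fix e :: real assume e: "e > 0"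
        define t where "t = e / (N + 1)"
        have "N * t = e * (N / (N + 1))" by (simp add: t_def)
        also have "\<dots> \<le> e * 1" using e by (intro mult_left_mono) auto
        finally have t: "t > 0" "N * t \<le> e" using e by (auto simp: t_def)
        have "ennreal (x i) \<le> ennreal (x i - t) + ennreal t" for i
          using t x[of i] by (cases "x i \<ge> t") (auto simp: ennreal_plus[symmetric] ennreal_neg simp del: ennreal_plus intro: ennreal_leI)
        then have "(\<Sum>i<N. ennreal (x i)) \<le> (\<Sum>i<N. ennreal (x i - t) + ennreal t)" by (rule sum_mono)
        also have "\<dots> = (\<Sum>i<N. ennreal (x i - t)) + ennreal (N * t)"
          using t by (simp add: sum.distrib ennreal_mult ennreal_of_nat_eq_real_of_nat)
        also have "\<dots> \<le> (\<Sum>n. ennreal (x n - t)) + ennreal e"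
          using t by (intro add_mono sum_le_suminf ennreal_leI) auto
        also have "\<dots> \<le> (\<Sum>n. ennreal (y n - t)) + ennreal e" by (intro add_right_mono ex t)
        also have "\<dots> \<le> (\<Sum>n. ennreal (y n)) + ennreal e"
          using t by (intro add_right_mono suminf_le ennreal_leI) auto
        finally show "(\<Sum>i<N. ennreal (x i)) \<le> (\<Sum>n. ennreal (y n)) + ennreal e" .
      qed
    qed simp
    then show ?thesis using True x y by simp
  next
    case False
    with p have p1: "1 < p" by simp
    define W where "W t = ennreal (p * (p - 1) * t powr (p - 2)) * indicator {0<..} t" for t
    have rep: "(\<Sum>n. ennreal (z n powr p)) = (\<integral>\<^sup>+t. W t * (\<Sum>n. ennreal (z n - t)) \<partial>lborel)"
      if z: "\<And>n. 0 \<le> z n" for z :: "nat \<Rightarrow> real"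
    proof -
      have "(\<Sum>n. ennreal (z n powr p)) = (\<Sum>n. \<integral>\<^sup>+t. W t * ennreal (z n - t) \<partial>lborel)"
        unfolding W_def by (simp add: powr_eq_nn_integral[OF z p1])
      also have "\<dots> = (\<integral>\<^sup>+t. (\<Sum>n. W t * ennreal (z n - t)) \<partial>lborel)"
        by (rule nn_integral_suminf[symmetric]) (simp add: W_def)
      finally show ?thesis by simp
    qed
    have "W t * (\<Sum>n. ennreal (x n - t)) \<le> W t * (\<Sum>n. ennreal (y n - t))" for t
      using ex[of t] by (cases "t > 0") (auto simp: W_def intro: mult_left_mono)
    then show ?thesis unfolding rep[OF x] rep[OF y] by (intro nn_integral_mono)
  qed
qed

theorem theorem3p2:
  fixes a b :: "'a::complex_hilbert \<Rightarrow>\<^sub>L 'a" and p :: ennreal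
  assumes "1 \<le> p"
    and "a \<in> schatten_class p"
    and "b \<in> schatten_class p"
  shows "(p < \<infinity> \<longrightarrow>
      (\<Sum>n. ennreal (\<bar>singular_value a n - singular_value b n\<bar> powr enn2real p))
        \<le> schatten_power (enn2real p) (a - b)) \<and>
    (p = \<infinity> \<longrightarrow>
      (SUP n. ennreal \<bar>singular_value a n - singular_value b n\<bar>) \<le> ennreal (norm (a - b)))"
proof (intro conjI impI)
  assume p: "p < \<infinity>"
  then have "p \<noteq> \<infinity>" by auto
  then have ab: "a \<in> compact_ops" "b \<in> compact_ops"
    using assms by (auto simp: schatten_class_def)
  have "1 \<le> enn2real p"
    using p assms(1) enn2real_mono[of 1 p] by simp
  then show "(\<Sum>n. ennreal (\<bar>singular_value a n - singular_value b n\<bar> powr enn2real p))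
      \<le> schatten_power (enn2real p) (a - b)"
    unfolding schatten_power_def singular_value_eq_approx_number
    by (intro suminf_powr_le approx_number_diff_excess_sum ab approx_number_nonneg) auto
next
  show "(SUP n. ennreal \<bar>singular_value a n - singular_value b n\<bar>) \<le> ennreal (norm (a - b))"
    unfolding singular_value_eq_approx_number
    by (intro SUP_least ennreal_leI abs_approx_number_diff)
qed

end
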